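(* Let $\gamma$ be the Euler constant. For every integer $n\ge 2$, \[\mathcal{E}_{s}(n)-\frac{2^{1-s}}{2-s}n^2\le-\frac{\Gamma(1-s/2)}{2^s}n^{1+s/2}\quad\text{for } 0<s<2,\] \[\mathcal{E}_{s}(n)-\frac{2^{1-s}}{2-s}n^2\ge-\frac{\Gamma(1-s/2)}{2^s}n^{1+s/2}\quad\text{for } -2<s<0,\] \[\mathcal{E}_{2}(n)-\frac14n^2\log n\le\frac{\gamma}{4}n^2.\]
   Context: Let $\mathbb{S}^2=\{p\in\mathbb{R}^3:|p|=1\}$ and let $|\cdot|$ be the Euclidean norm on $\mathbb{R}^3$. For real $s$ and points $x_1,\ldots,x_n\in\mathbb{S}^2$ the Riesz $s$-energy is $E_s(x_1,\ldots,x_n)=\sum_{i\neq j}|x_i-x_j|^{-s}$, the sum being over ordered pairs $(i,j)$ with $i\neq j$. The optimal $n$-point Riesz $s$-energy is \[\mathcal{E}_s(n)=\min\{E_s(x_1,\ldots,x_n):x_1,\ldots,x_n\in\mathbb{S}^2\}\ \text{ if } s\ge 0,\] \[\mathcal{E}_s(n)=\max\{E_s(x_1,\ldots,x_n):x_1,\ldots,x_n\in\mathbb{S}^2\}\ \text{ if } s<0.\] *)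

theory Defs
  imports "HOL-Analysis.Analysis"
begin

text \<open>The kernel is extended-real valued because \<open>0 powr (- s) = 0\<close> in HOL: for \<open>s > 0\<close> coinciding
  points must have infinite energy.  For \<open>s = 0\<close> the kernel is identically 1, and for \<open>s < 0\<close>
  coinciding points contribute 0.\<close>

definition riesz_kernel :: "real \<Rightarrow> real^3 \<Rightarrow> real^3 \<Rightarrow> ereal" where
  "riesz_kernel s p q =
     (if s > 0 \<and> p = q then \<infinity>
      else if s = 0 then 1
      else ereal (norm (p - q) powr (- s)))"

text \<open>A configuration of \<open>n\<close> points is given by the values of \<open>x\<close> on \<open>{..<n}\<close>.\<close>

definition riesz_energy :: "real \<Rightarrow> nat \<Rightarrow> (nat \<Rightarrow> real^3) \<Rightarrow> ereal" where
  "riesz_energy s n x =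
     (\<Sum>(i, j) \<in> {(i, j). i < n \<and> j < n \<and> i \<noteq> j}. riesz_kernel s (x i) (x j))"

definition sphere_energies :: "real \<Rightarrow> nat \<Rightarrow> ereal set" where
  "sphere_energies s n = {riesz_energy s n x | x. \<forall>i<n. x i \<in> sphere 0 1}"

text \<open>\<open>LEAST\<close> and \<open>GREATEST\<close> denote an attained minimum and maximum, not merely an infimum and
  supremum.\<close>

definition optimal_riesz_energy :: "real \<Rightarrow> nat \<Rightarrow> ereal" where
  "optimal_riesz_energy s n =
     (if s \<ge> 0 then (LEAST e. e \<in> sphere_energies s n)
      else (GREATEST e. e \<in> sphere_energies s n))"

end

theory Submission
  imports Defs "HOL-Probability.Probability_Measure"
begin

text \<open>The bounds are the mean energy of the spherical ensemble, the determinantal point process on the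
  sphere with density proportional to \<open>\<Prod>\<^bsub>i<j\<^esub> |x\<^sub>i - x\<^sub>j|\<^sup>2\<close>.  Its two-point intensity relative to the uniform
  measure is \<open>n\<^sup>2 (1 - z\<^bsup>n-1\<^esup>)\<close> with \<open>z = 1 - |x - y|\<^sup>2 / 4\<close>, and \<open>z\<close> is uniform on \<open>[0, 1]\<close>.  For \<open>s = 2\<close> the
  individual terms of the determinantal expansion are not integrable, so averages are only taken of
  polynomials in \<open>z\<close>.  These are separable, so that the moments factor over the points.  The Riesz
  kernel is a binomial series in \<open>z\<close> whose nonconstant coefficients all have the same sign, and
  compactness yields one configuration that is good for all partial sums.\<close>

section \<open>Moments of a determinantal point process\<close>

text \<open>With a = s/2, integrating the kernel against the two-point density gives 2^(-s) n^2
  times the integral of (1 - z)^(-a) (1 - z^(n-1)) over [0, 1]. Its first part is exactly the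
  subtracted n^2 term. Its second part is a Beta value, which log-convexity of Gamma compares with
  n^(1+a); the direction of that comparison depends on the sign of a, as does the choice between
  minimum and maximum. At a = 1 the two parts diverge separately, but together they give the
  harmonic number H_(n-1), whence the constant \<gamma>. A configuration found by averaging depends
  on the degree of the truncation, and a bound on finitely many powers of z does not exclude
  coinciding points. Both obstacles are removed by a configuration that obeys the limiting bound at
  every truncation.\<close>

definition bounded_measurable :: "'a measure \<Rightarrow> ('a \<Rightarrow> complex) \<Rightarrow> bool" where
  "bounded_measurable M f \<longleftrightarrow>
     f \<in> borel_measurable M \<and> (\<exists>B. \<forall>x\<in>space M. norm (f x) \<le> B)"

lemma bounded_measurable_const: "bounded_measurable M (\<lambda>_. c)"
  by (auto simp: bounded_measurable_def)

lemma bounded_measurable_cnj: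
  assumes "bounded_measurable M f" shows "bounded_measurable M (\<lambda>x. cnj (f x))"
  using assms borel_measurable_continuous_onI[OF continuous_on_cnj[OF continuous_on_id]]
  by (auto simp: bounded_measurable_def)

lemma bounded_measurable_mult:
  assumes "bounded_measurable M f" "bounded_measurable M g"
  shows "bounded_measurable M (\<lambda>x. f x * g x)"
proof -
  obtain B C where "\<forall>x\<in>space M. norm (f x) \<le> B" "\<forall>x\<in>space M. norm (g x) \<le> C"
    using assms by (auto simp: bounded_measurable_def)
  then have "\<forall>x\<in>space M. norm (f x * g x) \<le> B * C"
    by (metis (no_types) mult_mono norm_ge_zero norm_mult order_trans)
  with assms show ?thesis by (auto simp: bounded_measurable_def)
qed

lemma bounded_measurable_add:
  assumes "bounded_measurable M f" "bounded_measurable M g"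
  shows "bounded_measurable M (\<lambda>x. f x + g x)"
proof -
  obtain B C where "\<forall>x\<in>space M. norm (f x) \<le> B" "\<forall>x\<in>space M. norm (g x) \<le> C"
    using assms by (auto simp: bounded_measurable_def)
  then have "\<forall>x\<in>space M. norm (f x + g x) \<le> B + C"
    by (meson norm_triangle_mono)
  with assms show ?thesis by (auto simp: bounded_measurable_def)
qed

lemma bounded_measurable_power:
  "bounded_measurable M f \<Longrightarrow> bounded_measurable M (\<lambda>x. f x ^ m)"
  by (induction m) (auto intro: bounded_measurable_const bounded_measurable_mult)

lemma bounded_measurable_sum:
  "(\<And>i. i \<in> A \<Longrightarrow> bounded_measurable M (f i)) \<Longrightarrow> bounded_measurable M (\<lambda>x. \<Sum>i\<in>A. f i x)"
  by (induction A rule: infinite_finite_induct)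
     (auto intro: bounded_measurable_const bounded_measurable_add)

lemmas bounded_measurable_intros =
  bounded_measurable_const bounded_measurable_cnj bounded_measurable_mult
  bounded_measurable_power bounded_measurable_sum

text \<open>Products of integrable functions need not be integrable, whereas bounded measurable
  functions are closed under products. On a probability space the integrability conditions below
  thus reduce to closure rules.\<close>

lemma (in finite_measure) bounded_measurable_integrable:
  "bounded_measurable M f \<Longrightarrow> integrable M f"
  unfolding bounded_measurable_def by (auto intro!: integrable_const_bound AE_I2)

locale orthonormal_system = prob_space M for M :: "'a measure" +
  fixes n :: nat and \<phi> :: "nat \<Rightarrow> 'a \<Rightarrow> complex"
  assumes bounded_measurable_phi: "\<And>k. k < n \<Longrightarrow> bounded_measurable M (\<phi> k)"
    and orthonormal: "\<And>k l. k < n \<Longrightarrow> l < n \<Longrightarrow>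
      (\<integral>x. \<phi> k x * cnj (\<phi> l x) \<partial>M) = (if k = l then 1 else 0)"
begin

abbreviation perms :: "(nat \<Rightarrow> nat) set" where
  "perms \<equiv> {\<sigma>. \<sigma> permutes {..<n}}"

abbreviation confs :: "(nat \<Rightarrow> 'a) measure" where
  "confs \<equiv> Pi\<^sub>M {..<n} (\<lambda>_. M)"

text \<open>The determinant of the matrix \<open>\<phi> k (x i)\<close>, in Leibniz form so that
  every term is a product of functions of one point each.\<close>

definition slater :: "(nat \<Rightarrow> 'a) \<Rightarrow> complex" where
  "slater x = (\<Sum>\<sigma>\<in>perms. of_int (sign \<sigma>) * (\<Prod>i<n. \<phi> (\<sigma> i) (x i)))"

text \<open>Multiplication by \<open>p\<close>, compressed to the span of the orthonormal
  functions.\<close>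

definition gram :: "('a \<Rightarrow> complex) \<Rightarrow> nat \<Rightarrow> nat \<Rightarrow> complex" where
  "gram p k l = (\<integral>x. p x * (\<phi> k x * cnj (\<phi> l x)) \<partial>M)"

text \<open>The integral kernel of the orthogonal projection onto the span of the
  \<open>\<phi> k\<close>.\<close>

definition kernel :: "'a \<Rightarrow> 'a \<Rightarrow> complex" where
  "kernel x y = (\<Sum>k<n. \<phi> k x * cnj (\<phi> k y))"

lemma sign_square: "of_int (sign \<sigma>) * of_int (sign \<sigma>) = (1 :: complex)"
  by (simp add: sign_def)

lemma finite_perms: "finite perms"
  by (simp add: finite_permutations)

lemma perms_less: "\<sigma> permutes {..<n} \<Longrightarrow> i < n \<Longrightarrow> \<sigma> i < n"
  using permutes_in_image by fastforce

lemma gram_one: "k < n \<Longrightarrow> l < n \<Longrightarrow> gram (\<lambda>_. 1) k l = (if k = l then 1 else 0)"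
  by (simp add: gram_def orthonormal)

lemma kernel_reproducing: "(\<integral>y. kernel x y * kernel y x \<partial>M) = kernel x x"
proof -
  have "kernel x y * kernel y x = (\<Sum>k<n. \<Sum>l<n. (\<phi> k x * cnj (\<phi> l x)) * (\<phi> l y * cnj (\<phi> k y)))" for y
    unfolding kernel_def sum_product by (intro sum.cong refl) (simp add: mult_ac)
  then have "(\<integral>y. kernel x y * kernel y x \<partial>M) =
      (\<integral>y. (\<Sum>k<n. \<Sum>l<n. (\<phi> k x * cnj (\<phi> l x)) * (\<phi> l y * cnj (\<phi> k y))) \<partial>M)"
    by simp
  also have "\<dots> = (\<Sum>k<n. \<Sum>l<n. (\<phi> k x * cnj (\<phi> l x)) * (\<integral>y. \<phi> l y * cnj (\<phi> k y) \<partial>M))"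
    by (intro has_bochner_integral_integral_eq has_bochner_integral_sum
        has_bochner_integral_mult_right has_bochner_integral_integrable
        bounded_measurable_integrable bounded_measurable_intros bounded_measurable_phi) auto
  also have "\<dots> = (\<Sum>k<n. \<Sum>l<n. if l = k then \<phi> k x * cnj (\<phi> l x) else 0)"
    by (intro sum.cong refl) (simp add: orthonormal)
  also have "\<dots> = kernel x x"
    by (simp add: kernel_def)
  finally show ?thesis .
qed

text \<open>Expanding both determinants leaves, for each pair of permutations, a product of
  functions of separate points, whose integral factors by Fubini.\<close>

lemma slater_product_moment:
  assumes w: "\<And>i. i < n \<Longrightarrow> bounded_measurable M (w i)"
  shows "integrable confs (\<lambda>x. (\<Prod>i<n. w i (x i)) * (slater x * cnj (slater x)))" (is ?I)
    and "(\<integral>x. (\<Prod>i<n. w i (x i)) * (slater x * cnj (slater x)) \<partial>confs) =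
      (\<Sum>\<sigma>\<in>perms. \<Sum>\<tau>\<in>perms. of_int (sign \<sigma> * sign \<tau>) * (\<Prod>i<n. gram (w i) (\<sigma> i) (\<tau> i)))" (is ?E)
proof -
  interpret product_sigma_finite "\<lambda>_::nat. M" by unfold_locales
  have expand: "(\<Prod>i<n. w i (x i)) * (slater x * cnj (slater x)) =
      (\<Sum>\<sigma>\<in>perms. \<Sum>\<tau>\<in>perms. of_int (sign \<sigma> * sign \<tau>) *
        (\<Prod>i<n. w i (x i) * (\<phi> (\<sigma> i) (x i) * cnj (\<phi> (\<tau> i) (x i)))))" for x
    unfolding slater_def cnj_sum unfolding sum_product unfolding sum_distrib_left
    by (intro sum.cong refl) (simp add: prod.distrib mult_ac)
  have int: "integrable M (\<lambda>x. w i x * (\<phi> (\<sigma> i) x * cnj (\<phi> (\<tau> i) x)))"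
    if "\<sigma> \<in> perms" "\<tau> \<in> perms" "i \<in> {..<n}" for \<sigma> \<tau> i
    using that by (intro bounded_measurable_integrable bounded_measurable_intros w
        bounded_measurable_phi) (auto simp: perms_less)
  show ?I
    unfolding expand
    by (intro Bochner_Integration.integrable_sum integrable_mult_right product_integrable_prod int) auto
  show ?E
    unfolding expand gram_def
  proof (intro has_bochner_integral_integral_eq has_bochner_integral_sum
      has_bochner_integral_mult_right)
    fix \<sigma> \<tau> assume st: "\<sigma> \<in> perms" "\<tau> \<in> perms"
    show "has_bochner_integral confs
        (\<lambda>x. \<Prod>i<n. w i (x i) * (\<phi> (\<sigma> i) (x i) * cnj (\<phi> (\<tau> i) (x i))))
        (\<Prod>i<n. \<integral>x. w i x * (\<phi> (\<sigma> i) x * cnj (\<phi> (\<tau> i) x)) \<partial>M)"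
      unfolding has_bochner_integral_iff
      by (intro conjI product_integrable_prod product_integral_prod int st) auto
  qed
qed

text \<open>For constant weights 1 the Gram matrix is the identity, so only pairs of equal
  permutations survive, each contributing 1.\<close>

lemma slater_norm_square:
  "integrable confs (\<lambda>x. slater x * cnj (slater x))"
  "(\<integral>x. slater x * cnj (slater x) \<partial>confs) = fact n"
proof -
  note A = slater_product_moment[of "\<lambda>_ _. 1", OF bounded_measurable_const]
  show "integrable confs (\<lambda>x. slater x * cnj (slater x))" using A(1) by simp
  have "(\<integral>x. slater x * cnj (slater x) \<partial>confs) = (\<Sum>\<sigma>\<in>perms. \<Sum>\<tau>\<in>perms. of_int (sign \<sigma> * sign \<tau>) *
      (\<Prod>i<n. gram (\<lambda>_. 1) (\<sigma> i) (\<tau> i)))"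
    using A(2) by simp
  also have "\<dots> = (\<Sum>\<sigma>\<in>perms. \<Sum>\<tau>\<in>perms. if \<sigma> = \<tau> then 1 else 0)"
  proof (intro sum.cong refl)
    fix \<sigma> \<tau> assume st: "\<sigma> \<in> perms" "\<tau> \<in> perms"
    show "of_int (sign \<sigma> * sign \<tau>) * (\<Prod>i<n. gram (\<lambda>_. 1) (\<sigma> i) (\<tau> i)) =
        (if \<sigma> = \<tau> then 1 else (0::complex))"
    proof (cases "\<sigma> = \<tau>")
      case True
      then show ?thesis using st
        by (simp add: gram_one perms_less sign_square)
    next
      case False
      then obtain i where "\<sigma> i \<noteq> \<tau> i" by auto
      moreover from this have "i < n" using st
        by (metis lessThan_iff mem_Collect_eq permutes_not_in)
      ultimately have "(\<Prod>i<n. gram (\<lambda>_. 1) (\<sigma> i) (\<tau> i)) = 0"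
        using st by (intro prod_zero bexI[of _ i]) (auto simp: gram_one perms_less)
      with False show ?thesis by simp
    qed
  qed
  also have "\<dots> = of_nat (card perms)"
    by (simp add: finite_perms)
  also have "card perms = fact n"
    by (simp add: card_permutations)
  finally show "(\<integral>x. slater x * cnj (slater x) \<partial>confs) = fact n" by simp
qed

lemma slater_pair_moment:
  assumes p: "bounded_measurable M p" and q: "bounded_measurable M q"
    and ij: "i < n" "j < n" "i \<noteq> j"
  shows "integrable confs (\<lambda>x. p (x i) * q (x j) * (slater x * cnj (slater x)))" (is ?I)
    and "(\<integral>x. p (x i) * q (x j) * (slater x * cnj (slater x)) \<partial>confs) =
      (\<Sum>\<sigma>\<in>perms. gram p (\<sigma> i) (\<sigma> i) * gram q (\<sigma> j) (\<sigma> j)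
                  - gram p (\<sigma> i) (\<sigma> j) * gram q (\<sigma> j) (\<sigma> i))" (is ?E)
proof -
  define w where "w l = (if l = i then p else if l = j then q else (\<lambda>_. 1))" for l
  have split: "(\<Prod>l<n. f l) = f i * f j * (\<Prod>l\<in>{..<n} - {i, j}. f l)" for f :: "nat \<Rightarrow> complex"
  proof -
    have "(\<Prod>l<n. f l) = (\<Prod>l\<in>{i, j}. f l) * (\<Prod>l\<in>{..<n} - {i, j}. f l)"
      using ij prod.subset_diff[of "{i,j}" "{..<n}" f] by (simp add: mult.commute)
    then show ?thesis using ij by simp
  qed
  have w: "bounded_measurable M (w l)" for l
    using p q by (simp add: w_def bounded_measurable_const)
  have prod_w: "(\<Prod>l<n. w l (x l)) = p (x i) * q (x j)" for x
    using ij by (subst split) (simp add: w_def)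
  note A = slater_product_moment[of w, OF w, unfolded prod_w]
  show ?I by (rule A(1))
  have "(\<Sum>\<tau>\<in>perms. of_int (sign \<sigma> * sign \<tau>) * (\<Prod>l<n. gram (w l) (\<sigma> l) (\<tau> l))) =
      gram p (\<sigma> i) (\<sigma> i) * gram q (\<sigma> j) (\<sigma> j) - gram p (\<sigma> i) (\<sigma> j) * gram q (\<sigma> j) (\<sigma> i)"
    (is "sum ?f _ = _") if "\<sigma> \<in> perms" for \<sigma>
  proof -
    \<comment> \<open>Orthonormality kills every \<open>\<tau>\<close> that differs from \<open>\<sigma>\<close> outside \<open>{i, j}\<close>.\<close>
    define \<tau>' where "\<tau>' = \<sigma> \<circ> Transposition.transpose i j"
    have s: "\<sigma> permutes {..<n}" using that by simp
    have t: "\<tau>' permutes {..<n}"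
      unfolding \<tau>'_def using ij s by (intro permutes_compose permutes_swap_id) auto
    have "\<sigma> i \<noteq> \<sigma> j" using s ij by (metis permutes_inj inj_eq)
    then have "\<tau>' i \<noteq> \<sigma> i" by (simp add: \<tau>'_def)
    then have ne: "\<sigma> \<noteq> \<tau>'" by auto
    have "?f \<tau> = 0" if "\<tau> \<in> perms - {\<sigma>, \<tau>'}" for \<tau>
    proof (rule ccontr)
      assume nz: "?f \<tau> \<noteq> 0"
      have tp: "\<tau> permutes {..<n}" using that by simp
      have eq: "\<tau> l = \<sigma> l" if "l < n" "l \<noteq> i" "l \<noteq> j" for l
      proof (rule ccontr)
        assume "\<tau> l \<noteq> \<sigma> l"
        then have "gram (w l) (\<sigma> l) (\<tau> l) = 0"
          using that s tp by (auto simp: w_def gram_one perms_less)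
        with nz that(1) show False by (auto simp: prod_zero_iff)
      qed
      \<comment> \<open>Agreement outside \<open>{i, j}\<close> confines the quotient of the two
        permutations to a two-element set, which leaves the identity and the transposition.\<close>
      have "inv \<sigma> \<circ> \<tau> permutes {i, j}"
      proof (rule permutes_superset)
        show "inv \<sigma> \<circ> \<tau> permutes {..<n}" using s tp by (intro permutes_compose permutes_inv)
        show "\<And>x. x \<in> {..<n} - {i, j} \<Longrightarrow> (inv \<sigma> \<circ> \<tau>) x = x"
          using eq s by (auto simp: permutes_inverses)
      qed
      then have "inv \<sigma> \<circ> \<tau> = id \<or> inv \<sigma> \<circ> \<tau> = Transposition.transpose i j"
        by (simp add: permutes_doubleton_iff)
      moreover have "\<tau> = \<sigma> \<circ> (inv \<sigma> \<circ> \<tau>)"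
        using s by (simp add: fun_eq_iff permutes_inverses)
      ultimately show False using that by (auto simp: \<tau>'_def)
    qed
    then have "sum ?f perms = sum ?f {\<sigma>, \<tau>'}"
      using s t finite_perms by (intro sum.mono_neutral_right) auto
    also have "\<dots> = ?f \<sigma> + ?f \<tau>'" using ne by (simp add: sign_square)
    also have "?f \<sigma> = gram p (\<sigma> i) (\<sigma> i) * gram q (\<sigma> j) (\<sigma> j)"
      using ij s by (subst split) (simp add: w_def gram_one perms_less sign_square)
    also have "sign \<tau>' = - sign \<sigma>"
      using sign_compose[OF permutes_imp_permutation[OF _ s] permutation_swap_id[of i j]] ij
      by (simp add: \<tau>'_def sign_swap_id)
    also have "of_int (sign \<sigma> * - sign \<sigma>) * (\<Prod>l<n. gram (w l) (\<sigma> l) (\<tau>' l)) =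
        - (gram p (\<sigma> i) (\<sigma> j) * gram q (\<sigma> j) (\<sigma> i))"
      using ij s by (subst split)
        (simp add: w_def gram_one perms_less sign_square \<tau>'_def Transposition.transpose_def)
    finally show ?thesis by simp
  qed
  with A(2) show ?E by simp
qed

text \<open>Summed over all pairs of points, a permutation merely relabels the indices, so each of
  the n! permutations contributes the same double sum.\<close>

lemma slater_pair_sum:
  assumes p: "bounded_measurable M p" and q: "bounded_measurable M q"
  shows "(\<Sum>i<n. \<Sum>j\<in>{..<n} - {i}. (\<integral>x. p (x i) * q (x j) * (slater x * cnj (slater x)) \<partial>confs)) =
      fact n * (\<Sum>k<n. \<Sum>l<n. gram p k k * gram q l l - gram p k l * gram q l k)"
proof -
  define H where "H k l = gram p k k * gram q l l - gram p k l * gram q l k" for k l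
  have "(\<Sum>i<n. \<Sum>j\<in>{..<n} - {i}. (\<integral>x. p (x i) * q (x j) * (slater x * cnj (slater x)) \<partial>confs)) =
      (\<Sum>i<n. \<Sum>j\<in>{..<n} - {i}. \<Sum>\<sigma>\<in>perms. H (\<sigma> i) (\<sigma> j))"
    unfolding H_def by (intro sum.cong refl slater_pair_moment(2)[OF p q]) auto
  \<comment> \<open>\<open>H\<close> vanishes on the diagonal, so the pairs with i = j may be added;
    the two sums can then be reindexed independently.\<close>
  also have "\<dots> = (\<Sum>i<n. \<Sum>j<n. \<Sum>\<sigma>\<in>perms. H (\<sigma> i) (\<sigma> j))"
    by (intro sum.cong refl sum.mono_neutral_left) (auto simp: H_def)
  also have "\<dots> = (\<Sum>\<sigma>\<in>perms. \<Sum>i<n. \<Sum>j<n. H (\<sigma> i) (\<sigma> j))"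
    by (simp add: sum.swap[of _ perms])
  also have "\<dots> = (\<Sum>\<sigma>\<in>perms. \<Sum>k<n. \<Sum>l<n. H k l)"
  proof (rule sum.cong[OF refl])
    fix \<sigma> assume "\<sigma> \<in> perms"
    then have s: "\<sigma> permutes {..<n}" by simp
    have "(\<Sum>i<n. \<Sum>j<n. H (\<sigma> i) (\<sigma> j)) = (\<Sum>i<n. \<Sum>l<n. H (\<sigma> i) l)"
      by (intro sum.cong refl sum.permute[OF s, unfolded o_def, symmetric])
    also have "\<dots> = (\<Sum>k<n. \<Sum>l<n. H k l)"
      by (rule sum.permute[OF s, unfolded o_def, symmetric])
    finally show "(\<Sum>i<n. \<Sum>j<n. H (\<sigma> i) (\<sigma> j)) = (\<Sum>k<n. \<Sum>l<n. H k l)" .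
  qed
  also have "\<dots> = fact n * (\<Sum>k<n. \<Sum>l<n. H k l)"
    by (simp add: card_permutations)
  finally show ?thesis by (simp add: H_def)
qed

text \<open>The two-point intensity of a determinantal process is the 2 by 2 determinant of
  \<open>kernel\<close>. The factor \<open>fact n\<close> is the total mass of the unnormalised
  weight. Separability of \<open>h\<close> reduces each expectation to Gram entries, that is, to
  integrals over one point.\<close>

lemma slater_two_point:
  assumes fin: "finite A"
    and p: "\<And>a. a \<in> A \<Longrightarrow> bounded_measurable M (p a)"
    and q: "\<And>a. a \<in> A \<Longrightarrow> bounded_measurable M (q a)"
    and h: "\<And>x y. h x y = (\<Sum>a\<in>A. p a x * q a y)"
  shows "integrable confs (\<lambda>x. (\<Sum>i<n. \<Sum>j\<in>{..<n} - {i}. h (x i) (x j)) * (slater x * cnj (slater x)))"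
      (is ?I)
    and "(\<integral>x. (\<Sum>i<n. \<Sum>j\<in>{..<n} - {i}. h (x i) (x j)) * (slater x * cnj (slater x)) \<partial>confs) =
      fact n * (\<integral>x. (\<integral>y. h x y * (kernel x x * kernel y y - kernel x y * kernel y x) \<partial>M) \<partial>M)"
      (is ?E)
proof -
  have int: "integrable confs (\<lambda>x. p a (x i) * q a (x j) * (slater x * cnj (slater x)))"
    if "a \<in> A" "i \<in> {..<n}" "j \<in> {..<n} - {i}" for a i j
    using that by (intro slater_pair_moment(1) p q) auto
  have expand: "(\<Sum>i<n. \<Sum>j\<in>{..<n} - {i}. h (x i) (x j)) * (slater x * cnj (slater x)) =
     (\<Sum>i<n. \<Sum>j\<in>{..<n} - {i}. \<Sum>a\<in>A. p a (x i) * q a (x j) * (slater x * cnj (slater x)))" for x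
    unfolding h by (simp add: sum_distrib_right)
  show ?I
    unfolding expand by (intro Bochner_Integration.integrable_sum int)
  have "(\<integral>x. (\<Sum>i<n. \<Sum>j\<in>{..<n} - {i}. h (x i) (x j)) * (slater x * cnj (slater x)) \<partial>confs) =
      (\<Sum>i<n. \<Sum>j\<in>{..<n} - {i}. \<Sum>a\<in>A.
        (\<integral>x. p a (x i) * q a (x j) * (slater x * cnj (slater x)) \<partial>confs))"
    unfolding expand
    by (intro has_bochner_integral_integral_eq has_bochner_integral_sum
        has_bochner_integral_integrable int)
  also have "\<dots> = (\<Sum>a\<in>A. \<Sum>i<n. \<Sum>j\<in>{..<n} - {i}.
        (\<integral>x. p a (x i) * q a (x j) * (slater x * cnj (slater x)) \<partial>confs))"
    by (simp add: sum.swap[of _ A])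
  also have "\<dots> = (\<Sum>a\<in>A. fact n * (\<Sum>k<n. \<Sum>l<n.
      gram (p a) k k * gram (q a) l l - gram (p a) k l * gram (q a) l k))"
    by (intro sum.cong refl slater_pair_sum p q)
  also have "\<dots> = fact n * (\<Sum>a\<in>A. \<Sum>k<n. \<Sum>l<n.
      gram (p a) k k * gram (q a) l l - gram (p a) k l * gram (q a) l k)"
    by (simp add: sum_distrib_left)
  also have "(\<Sum>a\<in>A. \<Sum>k<n. \<Sum>l<n.
        gram (p a) k k * gram (q a) l l - gram (p a) k l * gram (q a) l k) =
     (\<integral>x. (\<integral>y. h x y * (kernel x x * kernel y y - kernel x y * kernel y x) \<partial>M) \<partial>M)"
  proof -
    define P where "P a k l x = p a x * (\<phi> k x * cnj (\<phi> l x))" for a k l x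
    define Q where "Q a k l x = q a x * (\<phi> k x * cnj (\<phi> l x))" for a k l x
    have gramQ: "gram (q a) k l = integral\<^sup>L M (Q a k l)" for a k l
      unfolding gram_def Q_def ..
    have gramP: "gram (p a) k l = integral\<^sup>L M (P a k l)" for a k l
      unfolding gram_def P_def ..
    have intP: "integrable M (P a k l)" if "a \<in> A" "k \<in> {..<n}" "l \<in> {..<n}" for a k l
      using that unfolding P_def
      by (intro bounded_measurable_integrable bounded_measurable_intros p bounded_measurable_phi) auto
    have intQ: "integrable M (Q a k l)" if "a \<in> A" "k \<in> {..<n}" "l \<in> {..<n}" for a k l
      using that unfolding Q_def
      by (intro bounded_measurable_integrable bounded_measurable_intros q bounded_measurable_phi) auto
    have "h x y * (kernel x x * kernel y y - kernel x y * kernel y x) =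
       (\<Sum>a\<in>A. \<Sum>k<n. \<Sum>l<n. P a k k x * Q a l l y - P a k l x * Q a l k y)" for x y
    proof -
      have "(kernel x x * kernel y y - kernel x y * kernel y x) =
        (\<Sum>k<n. \<Sum>l<n. (\<phi> k x * cnj (\<phi> k x)) * (\<phi> l y * cnj (\<phi> l y)) -
             (\<phi> k x * cnj (\<phi> l x)) * (\<phi> l y * cnj (\<phi> k y)))"
        unfolding kernel_def sum_product sum_subtractf[symmetric]
        by (intro sum.cong refl) (simp add: mult_ac)
      then have "h x y * (kernel x x * kernel y y - kernel x y * kernel y x) =
          (\<Sum>a\<in>A. \<Sum>k<n. \<Sum>l<n. p a x * q a y *
             ((\<phi> k x * cnj (\<phi> k x)) * (\<phi> l y * cnj (\<phi> l y)) -
             (\<phi> k x * cnj (\<phi> l x)) * (\<phi> l y * cnj (\<phi> k y))))"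
        unfolding h by (simp only: sum_distrib_right) (simp only: sum_distrib_left)
      also have "\<dots> = (\<Sum>a\<in>A. \<Sum>k<n. \<Sum>l<n. P a k k x * Q a l l y - P a k l x * Q a l k y)"
        unfolding P_def Q_def by (intro sum.cong refl) (simp add: algebra_simps)
      finally show ?thesis .
    qed
    then have "(\<integral>x. (\<integral>y. h x y * (kernel x x * kernel y y - kernel x y * kernel y x) \<partial>M) \<partial>M) =
       (\<integral>x. (\<integral>y. (\<Sum>a\<in>A. \<Sum>k<n. \<Sum>l<n. P a k k x * Q a l l y - P a k l x * Q a l k y) \<partial>M) \<partial>M)"
      by simp
    also have "\<dots> = (\<integral>x. (\<Sum>a\<in>A. \<Sum>k<n. \<Sum>l<n. P a k k x * gram (q a) l l - P a k l x * gram (q a) l k) \<partial>M)"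
    proof (intro Bochner_Integration.integral_cong refl)
      fix x
      have "has_bochner_integral M (\<lambda>y. \<Sum>a\<in>A. \<Sum>k<n. \<Sum>l<n. P a k k x * Q a l l y - P a k l x * Q a l k y)
        (\<Sum>a\<in>A. \<Sum>k<n. \<Sum>l<n. P a k k x * integral\<^sup>L M (Q a l l) - P a k l x * integral\<^sup>L M (Q a l k))"
        by (intro has_bochner_integral_sum has_bochner_integral_diff has_bochner_integral_mult_right
            has_bochner_integral_integrable intQ)
      then show "(\<integral>y. (\<Sum>a\<in>A. \<Sum>k<n. \<Sum>l<n. P a k k x * Q a l l y - P a k l x * Q a l k y) \<partial>M) =
         (\<Sum>a\<in>A. \<Sum>k<n. \<Sum>l<n. P a k k x * gram (q a) l l - P a k l x * gram (q a) l k)"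
        unfolding gramQ by (rule has_bochner_integral_integral_eq)
    qed
    also have "\<dots> = (\<Sum>a\<in>A. \<Sum>k<n. \<Sum>l<n. integral\<^sup>L M (P a k k) * gram (q a) l l
        - integral\<^sup>L M (P a k l) * gram (q a) l k)"
      by (intro has_bochner_integral_integral_eq has_bochner_integral_sum has_bochner_integral_diff
           has_bochner_integral_mult_left has_bochner_integral_integrable intP)
    also have "\<dots> = (\<Sum>a\<in>A. \<Sum>k<n. \<Sum>l<n.
        gram (p a) k k * gram (q a) l l - gram (p a) k l * gram (q a) l k)"
      unfolding gramP ..
    finally show ?thesis ..
  qed
  finally show ?E .
qed

end

section \<open>The spherical ensemble\<close>

definition unit_interval :: "real measure" where
  "unit_interval = restrict_space lborel {0..1}"

text \<open>A point \<open>(u, t)\<close> stands for the point of the sphere at height \<open>1 - 2 u\<close> and longitude \<open>2 \<pi> t\<close>; by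
  Archimedes the measure \<open>base\<close> is the uniform one.  The pair \<open>(spin1, spin2)\<close> is a unit vector in \<open>\<complex>\<^sup>2\<close>
  above that point in the Hopf fibration.\<close>

definition base :: "(real \<times> real) measure" where
  "base = unit_interval \<Otimes>\<^sub>M unit_interval"

definition spin1 :: "real \<times> real \<Rightarrow> complex" where
  "spin1 x = of_real (sqrt (fst x)) * cis (2 * pi * snd x)"

definition spin2 :: "real \<times> real \<Rightarrow> complex" where
  "spin2 x = of_real (sqrt (1 - fst x))"

definition herm :: "real \<times> real \<Rightarrow> real \<times> real \<Rightarrow> complex" where
  "herm x y = spin1 x * cnj (spin1 y) + spin2 x * cnj (spin2 y)"

text \<open>Unlike \<open>herm\<close>, the squared modulus is independent of the phases chosen for
  the unit vectors in the Hopf fibres.\<close>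

definition overlap :: "real \<times> real \<Rightarrow> real \<times> real \<Rightarrow> real" where
  "overlap x y = (norm (herm x y))\<^sup>2"

text \<open>The monomials of degree N - 1 in the Hopf coordinates. The squared modulus of such a
  monomial integrates to the Beta value k! (N-1-k)! / N!, the reciprocal of the number under the
  square root.\<close>

definition harmonic_basis :: "nat \<Rightarrow> nat \<Rightarrow> real \<times> real \<Rightarrow> complex" where
  "harmonic_basis N k x =
     of_real (sqrt (real N * real ((N - 1) choose k))) * (spin1 x ^ k * spin2 x ^ (N - 1 - k))"

lemma space_unit_interval: "space unit_interval = {0..1}"
  by (simp add: unit_interval_def space_restrict_space)

lemma space_base: "space base = {0..1} \<times> {0..1}"
  by (simp add: base_def space_pair_measure space_unit_interval)

lemma measurable_unit_interval:
  fixes f :: "real \<Rightarrow> 'a::topological_space"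
  shows "f \<in> borel_measurable borel \<Longrightarrow> f \<in> borel_measurable unit_interval"
  by (simp add: unit_interval_def measurable_restrict_space1)

interpretation unit_interval: prob_space unit_interval
  unfolding unit_interval_def by (rule prob_space_restrict_space) simp_all

interpretation base: pair_prob_space unit_interval unit_interval ..

lemma prob_space_base: "prob_space base"
  unfolding base_def by unfold_locales

lemma integral_unit_interval:
  fixes f :: "real \<Rightarrow> 'a::euclidean_space"
  assumes "continuous_on {0..1} f"
  shows "integral\<^sup>L unit_interval f = integral {0..1} f"
  unfolding unit_interval_def
  using borel_integrable_atLeastAtMost'[OF assms]
  by (subst integral_restrict_space)
     (auto simp: set_borel_integral_eq_integral(2)[unfolded set_lebesgue_integral_def])

lemma integral_base_product:
  fixes f g :: "real \<Rightarrow> complex"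
  assumes "bounded_measurable unit_interval f" "bounded_measurable unit_interval g"
  shows "(\<integral>x. f (fst x) * g (snd x) \<partial>base) =
    integral\<^sup>L unit_interval f * integral\<^sup>L unit_interval g"
proof -
  interpret B: prob_space base by (rule prob_space_base)
  have m: "fst \<in> measurable base unit_interval" "snd \<in> measurable base unit_interval"
    by (simp_all add: base_def)
  have "bounded_measurable base (\<lambda>x. f (fst x))" "bounded_measurable base (\<lambda>x. g (snd x))"
    using assms measurable_compose[OF m(1)] measurable_compose[OF m(2)]
    by (auto simp: bounded_measurable_def space_base space_unit_interval)
  then have "integrable base (\<lambda>x. f (fst x) * g (snd x))"
    by (intro B.bounded_measurable_integrable bounded_measurable_mult)
  then have "integral\<^sup>L base (\<lambda>x. f (fst x) * g (snd x)) =
      (\<integral>u. (\<integral>t. f u * g t \<partial>unit_interval) \<partial>unit_interval)"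
    unfolding base_def by (subst base.integral_fst'[symmetric]) auto
  then show ?thesis by simp
qed

lemma bounded_measurable_spin: "bounded_measurable base spin1" "bounded_measurable base spin2"
proof -
  have m: "fst \<in> borel_measurable base" "snd \<in> borel_measurable base"
    unfolding base_def
    by (auto intro!: measurable_compose[OF measurable_fst] measurable_compose[OF measurable_snd]
        measurable_unit_interval)
  have r: "(\<lambda>u. complex_of_real (sqrt u)) \<in> borel_measurable borel"
    "(\<lambda>u. complex_of_real (sqrt (1 - u))) \<in> borel_measurable borel"
    "(\<lambda>t. cis (2 * pi * t)) \<in> borel_measurable borel"
    by (intro borel_measurable_continuous_onI continuous_intros)+
  show "bounded_measurable base spin1"
    unfolding bounded_measurable_def spin1_def[abs_def]
    using measurable_compose[OF m(1) r(1)] measurable_compose[OF m(2) r(3)]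
    by (intro conjI exI[of _ 1] borel_measurable_times) (auto simp: space_base norm_mult)
  show "bounded_measurable base spin2"
    unfolding bounded_measurable_def spin2_def[abs_def]
    using measurable_compose[OF m(1) r(2)]
    by (intro conjI exI[of _ 1]) (auto simp: space_base)
qed

lemma integral_cis_power:
  "(\<integral>t. cis (2 * pi * t) ^ k * cnj (cis (2 * pi * t) ^ l) \<partial>unit_interval) = (if k = l then 1 else 0)"
proof (cases "k = l")
  case True
  then show ?thesis
    by (simp add: cis_cnj cis_mult unit_interval.prob_space flip: power_mult_distrib)
next
  case False
  define d where "d = 2 * pi * (real k - real l)"
  have d: "d \<noteq> 0" using False by (simp add: d_def)
  have eq: "cis (2 * pi * t) ^ k * cnj (cis (2 * pi * t) ^ l) = cis (d * t)" for t
    by (simp add: Complex.DeMoivre cis_cnj cis_mult d_def algebra_simps)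
  have "((\<lambda>t. cis (d * t)) has_integral (cis (d * 1) / (\<i> * d) - cis (d * 0) / (\<i> * d))) {0..1}"
  proof (rule fundamental_theorem_of_calculus)
    fix t :: real
    have "((\<lambda>z. exp (\<i> * (d * z)) / (\<i> * d)) has_field_derivative exp (\<i> * (d * t))) (at (of_real t))"
      using d by (auto intro!: derivative_eq_intros simp: mult.commute mult.left_commute)
    then have "((\<lambda>t::real. exp (\<i> * (of_real d * of_real t)) / (\<i> * d)) has_vector_derivative exp (\<i> * (d * t)))
        (at t within {0..1})"
      by (rule has_vector_derivative_real_field)
    then show "((\<lambda>t. cis (d * t) / (\<i> * d)) has_vector_derivative cis (d * t)) (at t within {0..1})"
      by (simp add: cis_conv_exp mult_ac)
  qed simp
  moreover have "cis d = 1"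
    using cis_multiple_2pi[of "real k - real l"] by (simp add: d_def)
  ultimately have "integral {0..1} (\<lambda>t. cis (d * t)) = 0"
    by (simp add: integral_unique)
  moreover have "(\<integral>t. cis (d * t) \<partial>unit_interval) = integral {0..1} (\<lambda>t. cis (d * t))"
    by (intro integral_unit_interval continuous_intros)
  ultimately show ?thesis using False unfolding eq by simp
qed

lemma has_integral_Beta_nat:
  "((\<lambda>u::real. u ^ k * (1 - u) ^ m) has_integral (fact k * fact m / fact (k + m + 1))) {0..1}"
proof -
  have "((\<lambda>u. u powr (real (Suc k) - 1) * (1 - u) powr (real (Suc m) - 1)) has_integral
      Beta (real (Suc k)) (real (Suc m))) {0..1}"
    by (intro has_integral_Beta_real) auto
  moreover have "Beta (real (Suc k)) (real (Suc m)) = fact k * fact m / fact (k + m + 1)"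
    using Gamma_fact[of k, where 'a=real] Gamma_fact[of m, where 'a=real]
      Gamma_fact[of "k + m + 1", where 'a=real]
    by (simp add: Beta_def add_ac)
  \<comment> \<open>Since \<open>0 powr 0 = 0\<close> but \<open>0 ^ 0 = 1\<close>, the two
    integrands may differ at the endpoints, which are discarded as a finite set.\<close>
  ultimately show ?thesis
    using has_integral_spike_finite[of "{0, 1}" "{0..1}" "\<lambda>u. u ^ k * (1 - u) ^ m"
        "\<lambda>u. u powr (real (Suc k) - 1) * (1 - u) powr (real (Suc m) - 1)"]
    by (auto simp: powr_realpow)
qed

lemma integral_power_unit_interval:
  "(\<integral>u. complex_of_real (u ^ k * (1 - u) ^ m) \<partial>unit_interval) =
    of_real (fact k * fact m / fact (k + m + 1))"
proof -
  have "(\<integral>u. u ^ k * (1 - u) ^ m \<partial>unit_interval) = fact k * fact m / fact (k + m + 1)"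
    using has_integral_Beta_nat[of k m]
    by (subst integral_unit_interval) (auto intro!: continuous_intros integral_unique)
  then show ?thesis by (simp only: integral_complex_of_real)
qed

lemma bounded_measurable_harmonic_basis: "bounded_measurable base (harmonic_basis N k)"
  unfolding harmonic_basis_def[abs_def]
  by (intro bounded_measurable_intros bounded_measurable_spin)

text \<open>The integrand separates into height and longitude: the longitude factor gives the
  Kronecker delta, and the height factor is the Beta integral that the normalising constant
  inverts.\<close>

lemma harmonic_basis_orthonormal:
  assumes "k < N" "l < N"
  shows "(\<integral>x. harmonic_basis N k x * cnj (harmonic_basis N l x) \<partial>base) = (if k = l then 1 else 0)"
proof -
  define c where "c k = sqrt (real N * real ((N - 1) choose k))" for k
  define f where "f u = complex_of_real (c k * c l * (sqrt u ^ (k + l) * sqrt (1 - u) ^ (N - 1 - k + (N - 1 - l))))" for u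
  define g where "g t = cis (2 * pi * t) ^ k * cnj (cis (2 * pi * t) ^ l)" for t
  have fg: "harmonic_basis N k x * cnj (harmonic_basis N l x) = f (fst x) * g (snd x)" for x
    unfolding harmonic_basis_def f_def g_def c_def spin1_def spin2_def
    by (simp add: power_mult_distrib power_add mult_ac)
  have bg: "bounded_measurable unit_interval g"
    unfolding bounded_measurable_def g_def
    by (intro conjI exI[of _ 1] measurable_unit_interval borel_measurable_continuous_onI continuous_intros)
       (auto simp: norm_mult norm_power)
  have bf: "bounded_measurable unit_interval f"
  proof -
    have "continuous_on {0..1} f"
      unfolding f_def by (intro continuous_intros)
    then have "bounded (f ` {0..1})"
      by (intro compact_imp_bounded compact_continuous_image) auto
    moreover have "f \<in> borel_measurable borel"
      unfolding f_def by (intro borel_measurable_continuous_onI continuous_intros)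
    ultimately show ?thesis
      by (auto simp: bounded_measurable_def space_unit_interval bounded_iff
          intro!: measurable_unit_interval)
  qed
  have "integral\<^sup>L unit_interval g = (if k = l then 1 else 0)"
    unfolding g_def by (rule integral_cis_power)
  then have eq: "(\<integral>x. harmonic_basis N k x * cnj (harmonic_basis N l x) \<partial>base) =
      integral\<^sup>L unit_interval f * (if k = l then 1 else 0)"
    unfolding fg using integral_base_product[OF bf bg] by simp
  show ?thesis
  proof (cases "k = l")
    case True
    have "f u = of_real (real N * real ((N - 1) choose k)) * of_real (u ^ k * (1 - u) ^ (N - 1 - k))"
      if "u \<in> space unit_interval" for u
    proof -
      have "sqrt u ^ (k + k) = u ^ k" "sqrt (1 - u) ^ (N - 1 - k + (N - 1 - k)) = (1 - u) ^ (N - 1 - k)"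
        using that by (simp_all add: space_unit_interval power_add flip: power_mult_distrib)
      moreover have "c k * c k = real N * real ((N - 1) choose k)"
        by (simp add: c_def)
      ultimately show ?thesis using True unfolding f_def by simp
    qed
    then have "integral\<^sup>L unit_interval f = (\<integral>u. of_real (real N * real ((N - 1) choose k)) *
         complex_of_real (u ^ k * (1 - u) ^ (N - 1 - k)) \<partial>unit_interval)"
      by (intro Bochner_Integration.integral_cong refl)
    also have "\<dots> = of_real (real N * real ((N - 1) choose k) *
         (fact k * fact (N - 1 - k) / fact (k + (N - 1 - k) + 1)))"
      unfolding integral_mult_right_zero integral_power_unit_interval by (simp only: of_real_mult)
    also have "real N * real ((N - 1) choose k) *
         (fact k * fact (N - 1 - k) / fact (k + (N - 1 - k) + 1)) = 1"
    proof -
      obtain N' where N': "N = Suc N'" using assms by (cases N) auto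
      then have "k \<le> N'" using assms by simp
      have b: "fact k * fact (N' - k) * real (N' choose k) = fact N'"
        using \<open>k \<le> N'\<close> by (simp add: binomial_fact)
      have "real N * real ((N - 1) choose k) * (fact k * fact (N - 1 - k) / fact (k + (N - 1 - k) + 1)) =
          real (Suc N') * (fact k * fact (N' - k) * real (N' choose k)) / fact (Suc N')"
        using \<open>k \<le> N'\<close> by (simp add: N' mult_ac del: fact_Suc)
      also have "\<dots> = 1"
        unfolding b by (simp only: fact_Suc) simp
      finally show ?thesis .
    qed
    finally show ?thesis using eq True by simp
  qed (simp add: eq)
qed

lemma orthonormal_system_harmonic: "orthonormal_system base N (harmonic_basis N)"
  by (intro orthonormal_system.intro orthonormal_system_axioms.intro prob_space_base
      bounded_measurable_harmonic_basis harmonic_basis_orthonormal)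

lemma cnj_herm: "cnj (herm x y) = herm y x"
  by (simp add: herm_def mult_ac)

lemma overlap_complex: "complex_of_real (overlap x y) = herm x y * herm y x"
  unfolding overlap_def complex_norm_square cnj_herm ..

lemma herm_self:
  assumes "x \<in> space base" shows "herm x x = 1"
proof -
  have "herm x x = of_real ((norm (spin1 x))\<^sup>2 + (norm (spin2 x))\<^sup>2)"
    by (simp only: herm_def of_real_add complex_norm_square)
  also have "(norm (spin1 x))\<^sup>2 + (norm (spin2 x))\<^sup>2 = 1"
    using assms by (auto simp: spin1_def spin2_def norm_mult space_base)
  finally show ?thesis by simp
qed

lemma herm_power:
  "herm x y ^ m = (\<Sum>k\<le>m. of_nat (m choose k) * (spin1 x ^ k * spin2 x ^ (m - k)) *
     cnj (spin1 y ^ k * spin2 y ^ (m - k)))"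
  unfolding herm_def binomial_ring
  by (intro sum.cong refl) (simp add: power_mult_distrib mult_ac)

text \<open>The squared normalising constants are N times the coefficients of the binomial theorem,
  so the sum collapses to a power of \<open>herm\<close>.\<close>

lemma kernel_harmonic:
  assumes "N > 0"
  shows "orthonormal_system.kernel N (harmonic_basis N) x y = of_nat N * herm x y ^ (N - 1)"
proof -
  interpret orthonormal_system base N "harmonic_basis N" by (rule orthonormal_system_harmonic)
  have "kernel x y = (\<Sum>k\<le>N - 1. of_nat N * (of_nat ((N - 1) choose k) * (spin1 x ^ k * spin2 x ^ (N - 1 - k)) *
     cnj (spin1 y ^ k * spin2 y ^ (N - 1 - k))))"
    unfolding kernel_def
  proof (rule sum.cong)
    show "{..<N} = {..N - 1}" using assms by auto
    fix k
    have "harmonic_basis N k x * cnj (harmonic_basis N k y) =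
       of_real (sqrt (real N * real ((N - 1) choose k)) * sqrt (real N * real ((N - 1) choose k))) *
         ((spin1 x ^ k * spin2 x ^ (N - 1 - k)) * cnj (spin1 y ^ k * spin2 y ^ (N - 1 - k)))"
      unfolding harmonic_basis_def by (simp only: complex_cnj_mult complex_cnj_complex_of_real of_real_mult mult_ac)
    then show "harmonic_basis N k x * cnj (harmonic_basis N k y) = of_nat N * (of_nat ((N - 1) choose k) * (spin1 x ^ k * spin2 x ^ (N - 1 - k)) *
     cnj (spin1 y ^ k * spin2 y ^ (N - 1 - k)))"
      by (simp add: mult_ac)
  qed
  then show ?thesis
    unfolding herm_power sum_distrib_left .
qed

text \<open>The reproducing property of the kernel of size \<open>m + 1\<close> replaces a direct proof that \<open>overlap x\<close> is
  uniformly distributed.\<close>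

lemma integral_overlap_power:
  assumes "x \<in> space base"
  shows "(\<integral>y. complex_of_real (overlap x y ^ m) \<partial>base) = 1 / of_nat (m + 1)"
proof -
  interpret orthonormal_system base "m + 1" "harmonic_basis (m + 1)"
    by (rule orthonormal_system_harmonic)
  have "kernel x y * kernel y x = (of_nat (m + 1))\<^sup>2 * complex_of_real (overlap x y ^ m)" for y
    by (simp add: kernel_harmonic overlap_complex power_mult_distrib power2_eq_square mult_ac)
  then have "(of_nat (m + 1))\<^sup>2 * (\<integral>y. complex_of_real (overlap x y ^ m) \<partial>base) = kernel x x"
    using kernel_reproducing[of x] by (simp only: integral_mult_right_zero)
  also have "kernel x x = of_nat (m + 1)"
    using herm_self[OF assms] by (simp add: kernel_harmonic)
  finally have "of_nat (m + 1) * (of_nat (m + 1) * (\<integral>y. complex_of_real (overlap x y ^ m) \<partial>base)) =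
      of_nat (m + 1) * (1::complex)"
    by (simp only: power2_eq_square mult_1_right mult.assoc)
  then have "of_nat (m + 1) * (\<integral>y. complex_of_real (overlap x y ^ m) \<partial>base) = 1"
    by (subst (asm) mult_cancel_left) (metis of_nat_eq_0_iff add_is_0 one_neq_zero)
  then show ?thesis
    by (metis nonzero_mult_div_cancel_left mult_zero_left zero_neq_one)
qed

section \<open>Averages over the spherical ensemble\<close>

definition conf_space :: "nat \<Rightarrow> (nat \<Rightarrow> real \<times> real) set" where
  "conf_space n = {x. \<forall>i<n. x i \<in> space base}"

text \<open>For this basis the determinant is of Vandermonde type, proportional to the product over
  i < j of \<open>spin1 (x i) * spin2 (x j) - spin1 (x j) * spin2 (x i)\<close>, whose modulus is
  half the chord between the two points.\<close>

definition spherical_ensemble_weight :: "nat \<Rightarrow> (nat \<Rightarrow> real \<times> real) \<Rightarrow> real" where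
  "spherical_ensemble_weight n x = (norm (orthonormal_system.slater n (harmonic_basis n) x))\<^sup>2"

lemma spherical_ensemble_weight_total:
  "has_bochner_integral (Pi\<^sub>M {..<n} (\<lambda>_. base)) (spherical_ensemble_weight n) (fact n)"
proof -
  interpret orthonormal_system base n "harmonic_basis n" by (rule orthonormal_system_harmonic)
  have eq: "slater x * cnj (slater x) = of_real (spherical_ensemble_weight n x)" for x
    by (simp only: spherical_ensemble_weight_def complex_norm_square)
  have "has_bochner_integral confs (\<lambda>x. complex_of_real (spherical_ensemble_weight n x)) (fact n)"
    using slater_norm_square by (simp add: has_bochner_integral_iff eq)
  from has_bochner_integral_Re[OF this] show ?thesis
    by (metis (mono_tags, lifting) Re_complex_of_real of_real_fact has_bochner_integral_cong)
qed

text \<open>The two-point density brings in the moments of order m and m + n - 1 of a uniform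
  variable, which are 1/(m+1) and 1/(m+n).\<close>

lemma spherical_ensemble_moment:
  assumes "n > 0"
  shows "has_bochner_integral (Pi\<^sub>M {..<n} (\<lambda>_. base))
     (\<lambda>x. (\<Sum>i<n. \<Sum>j\<in>{..<n} - {i}. overlap (x i) (x j) ^ m) * spherical_ensemble_weight n x)
     (fact n * (real n ^ 2 * (1 / real (m + 1) - 1 / real (m + n))))"
proof -
  interpret orthonormal_system base n "harmonic_basis n" by (rule orthonormal_system_harmonic)
  define b where "b k x = spin1 x ^ k * spin2 x ^ (m - k)" for k x
  \<comment> \<open>Expanding \<open>herm x y ^ m\<close> and its conjugate by the binomial theorem
    gives (m+1)^2 separated terms; the binomial coefficients are all assigned to
    \<open>p\<close>.\<close>
  define p where "p = (\<lambda>(k, l) x. of_nat (m choose k) * of_nat (m choose l) * (b k x * cnj (b l x)))"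
  define q where "q = (\<lambda>(k, l) x. cnj (b k x) * b l x)"
  define h where "h x y = complex_of_real (overlap x y ^ m)" for x y
  have h: "h x y = (\<Sum>a\<in>{..m} \<times> {..m}. p a x * q a y)" for x y
  proof -
    have "h x y = herm x y ^ m * cnj (herm x y ^ m)"
      by (simp add: h_def overlap_complex power_mult_distrib cnj_herm)
    also have "\<dots> = (\<Sum>k\<le>m. \<Sum>l\<le>m. (of_nat (m choose k) * b k x * cnj (b k y)) *
        cnj (of_nat (m choose l) * b l x * cnj (b l y)))"
      unfolding herm_power b_def[symmetric] cnj_sum sum_product ..
    also have "\<dots> = (\<Sum>(k, l)\<in>{..m} \<times> {..m}. p (k, l) x * q (k, l) y)"
      unfolding sum.cartesian_product[symmetric] p_def q_def
      by (intro sum.cong refl) (simp add: mult_ac)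
    finally show ?thesis by (simp add: case_prod_beta)
  qed
  have bb: "bounded_measurable base (b k)" for k
    unfolding b_def by (intro bounded_measurable_intros bounded_measurable_spin)
  have bp: "bounded_measurable base (p a)" for a
    unfolding p_def by (cases a) (auto intro!: bounded_measurable_intros bb)
  have bq: "bounded_measurable base (q a)" for a
    unfolding q_def by (cases a) (auto intro!: bounded_measurable_intros bb)
  note two_point = slater_two_point[of "{..m} \<times> {..m}" p q h, OF _ bp bq h, simplified]
  have bov: "bounded_measurable base (\<lambda>y. complex_of_real (overlap x y ^ m))" for x m
    unfolding herm_def of_real_power overlap_complex
    by (intro bounded_measurable_intros bounded_measurable_add bounded_measurable_spin)
  define c where "c = (of_nat n)\<^sup>2 * (1 / of_nat (m + 1) - 1 / of_nat (m + n) :: complex)"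
  have inner: "(\<integral>y. h x y * (kernel x x * kernel y y - kernel x y * kernel y x) \<partial>base) = c"
    if x: "x \<in> space base" for x
  proof -
    have "h x y * (kernel x x * kernel y y - kernel x y * kernel y x) =
       (of_nat n)\<^sup>2 * (complex_of_real (overlap x y ^ m) - complex_of_real (overlap x y ^ (m + (n - 1))))"
      if y: "y \<in> space base" for y
      unfolding kernel_harmonic[OF assms] herm_self[OF x] herm_self[OF y] h_def
      by (simp add: overlap_complex power_mult_distrib power2_eq_square power_add algebra_simps)
    then have "(\<integral>y. h x y * (kernel x x * kernel y y - kernel x y * kernel y x) \<partial>base) =
      (\<integral>y. (of_nat n)\<^sup>2 * (complex_of_real (overlap x y ^ m) -
         complex_of_real (overlap x y ^ (m + (n - 1)))) \<partial>base)"
      by (intro Bochner_Integration.integral_cong refl)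
    also have "\<dots> = (of_nat n)\<^sup>2 * (1 / of_nat (m + 1) - 1 / of_nat (m + (n - 1) + 1))"
      unfolding integral_mult_right_zero
      by (subst Bochner_Integration.integral_diff)
         (simp_all only: bounded_measurable_integrable[OF bov] integral_overlap_power[OF x])
    finally show ?thesis using assms by (simp add: c_def)
  qed
  have "(\<integral>x. (\<integral>y. h x y * (kernel x x * kernel y y - kernel x y * kernel y x) \<partial>base) \<partial>base) =
      (\<integral>x. c \<partial>base)"
    by (intro Bochner_Integration.integral_cong refl inner)
  also have "\<dots> = c" by (simp add: prob_space)
  finally have c: "(\<integral>x. (\<integral>y. h x y * (kernel x x * kernel y y - kernel x y * kernel y x) \<partial>base) \<partial>base) = c" .
  have eq: "(\<Sum>i<n. \<Sum>j\<in>{..<n} - {i}. h (x i) (x j)) * (slater x * cnj (slater x)) =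
     of_real ((\<Sum>i<n. \<Sum>j\<in>{..<n} - {i}. overlap (x i) (x j) ^ m) * spherical_ensemble_weight n x)" for x
    by (simp only: spherical_ensemble_weight_def complex_norm_square of_real_mult of_real_sum h_def)
  have "has_bochner_integral confs (\<lambda>x. complex_of_real ((\<Sum>i<n. \<Sum>j\<in>{..<n} - {i}. overlap (x i) (x j) ^ m) *
       spherical_ensemble_weight n x)) (fact n * c)"
    using two_point unfolding has_bochner_integral_iff c eq by simp
  from has_bochner_integral_Re[OF this] show ?thesis
    unfolding Re_complex_of_real
  proof (rule has_bochner_integral_cong[THEN iffD1, rotated -1])
    have "fact n * c = complex_of_real (fact n * (real n ^ 2 * (1 / real (m + 1) - 1 / real (m + n))))"
      by (simp add: c_def)
    then show "Re (fact n * c) = fact n * (real n ^ 2 * (1 / real (m + 1) - 1 / real (m + n)))"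
      by (metis Re_complex_of_real)
  qed simp_all
qed

text \<open>First-moment method: some configuration does not exceed the weighted mean. Otherwise
  \<open>(F x - C) * w x\<close> would be nonnegative with integral 0, forcing \<open>w\<close> to
  vanish almost everywhere against its total mass n!.\<close>

lemma exists_conf_polynomial_energy_le:
  assumes "n > 0"
  shows "\<exists>x\<in>conf_space n. (\<Sum>i<n. \<Sum>j\<in>{..<n} - {i}. \<Sum>m<N. c m * overlap (x i) (x j) ^ m)
     \<le> real n ^ 2 * (\<Sum>m<N. c m * (1 / real (m + 1) - 1 / real (m + n)))"
proof (rule ccontr)
  define P where "P = Pi\<^sub>M {..<n} (\<lambda>_. base)"
  define w where "w = spherical_ensemble_weight n"
  define F where "F x = (\<Sum>i<n. \<Sum>j\<in>{..<n} - {i}. \<Sum>m<N. c m * overlap (x i) (x j) ^ m)" for x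
  define C where "C = real n ^ 2 * (\<Sum>m<N. c m * (1 / real (m + 1) - 1 / real (m + n)))"
  assume "\<not> (\<exists>x\<in>conf_space n. (\<Sum>i<n. \<Sum>j\<in>{..<n} - {i}. \<Sum>m<N. c m * overlap (x i) (x j) ^ m)
     \<le> real n ^ 2 * (\<Sum>m<N. c m * (1 / real (m + 1) - 1 / real (m + n))))"
  then have less: "C < F x" if "x \<in> conf_space n" for x
    using that by (auto simp: F_def C_def not_le)
  have sp: "x \<in> conf_space n" if "x \<in> space P" for x
    using that by (auto simp: P_def space_PiM conf_space_def)
  have "has_bochner_integral P
      (\<lambda>x. (\<Sum>m<N. c m * ((\<Sum>i<n. \<Sum>j\<in>{..<n} - {i}. overlap (x i) (x j) ^ m) * w x)) - C * w x)
      ((\<Sum>m<N. c m * (fact n * (real n ^ 2 * (1 / real (m + 1) - 1 / real (m + n))))) - C * fact n)"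
    unfolding P_def w_def
    by (intro has_bochner_integral_diff has_bochner_integral_sum has_bochner_integral_mult_right
        spherical_ensemble_moment spherical_ensemble_weight_total assms)
  also have "(\<lambda>x. (\<Sum>m<N. c m * ((\<Sum>i<n. \<Sum>j\<in>{..<n} - {i}. overlap (x i) (x j) ^ m) * w x)) - C * w x)
     = (\<lambda>x. (F x - C) * w x)"
  proof
    fix x
    have "(\<Sum>m<N. c m * ((\<Sum>i<n. \<Sum>j\<in>{..<n} - {i}. overlap (x i) (x j) ^ m) * w x)) = F x * w x"
      unfolding F_def sum.swap[of _ "{..<N}"] sum_distrib_left sum_distrib_right
      by (simp add: sum.swap[of _ "{..<N}"] sum_distrib_left mult_ac)
    then show "(\<Sum>m<N. c m * ((\<Sum>i<n. \<Sum>j\<in>{..<n} - {i}. overlap (x i) (x j) ^ m) * w x)) - C * w x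
      = (F x - C) * w x" by (simp add: algebra_simps)
  qed
  also have "(\<Sum>m<N. c m * (fact n * (real n ^ 2 * (1 / real (m + 1) - 1 / real (m + n))))) - C * fact n = 0"
    by (simp add: C_def sum_distrib_left mult_ac)
  finally have zero: "has_bochner_integral P (\<lambda>x. (F x - C) * w x) 0" .
  have "AE x in P. (F x - C) * w x = 0"
  proof (subst integral_nonneg_eq_0_iff_AE[symmetric])
    show "AE x in P. 0 \<le> (F x - C) * w x"
      using less sp by (intro AE_I2) (fastforce simp: w_def spherical_ensemble_weight_def)
  qed (use zero in \<open>auto simp: has_bochner_integral_iff\<close>)
  then have "AE x in P. w x = 0"
    by (rule AE_mp) (use less sp in \<open>fastforce intro!: AE_I2\<close>)
  moreover have "w \<in> borel_measurable P"
    using spherical_ensemble_weight_total[of n]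
    by (auto simp: w_def P_def dest: borel_measurable_has_bochner_integral)
  ultimately have "integral\<^sup>L P w = 0"
    by (subst integral_cong_AE[where g = "\<lambda>_. 0"]) auto
  moreover have "integral\<^sup>L P w = fact n"
    using spherical_ensemble_weight_total[of n]
    by (simp add: w_def P_def has_bochner_integral_integral_eq)
  ultimately show False by simp
qed

section \<open>Configurations on the sphere\<close>

text \<open>With polar angle \<theta> and 1 - 2 u = cos \<theta>, the horizontal radius 2 sqrt(u)
  sqrt(1 - u) is sin \<theta>.\<close>

definition sphere_point :: "real \<times> real \<Rightarrow> real^3" where
  "sphere_point x = vector [2 * sqrt (fst x) * sqrt (1 - fst x) * cos (2 * pi * snd x),
     2 * sqrt (fst x) * sqrt (1 - fst x) * sin (2 * pi * snd x), 1 - 2 * fst x]"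

text \<open>On the sphere this is the squared cosine of half the angle between the points.\<close>

definition chord_overlap :: "real^3 \<Rightarrow> real^3 \<Rightarrow> real" where
  "chord_overlap p q = 1 - (norm (p - q))\<^sup>2 / 4"

lemma chord_overlap_bounds:
  assumes "p \<in> sphere 0 1" "q \<in> sphere 0 1"
  shows "0 \<le> chord_overlap p q" "chord_overlap p q \<le> 1"
proof -
  have "norm (p - q) \<le> 2"
    using norm_triangle_ineq4[of p q] assms by simp
  then have "(norm (p - q))\<^sup>2 \<le> 2\<^sup>2"
    by (intro power_mono) auto
  then show "0 \<le> chord_overlap p q" by (simp add: chord_overlap_def)
qed (simp add: chord_overlap_def)

lemma chord_overlap_inner:
  assumes "p \<in> sphere 0 1" "q \<in> sphere 0 1"
  shows "chord_overlap p q = (1 + inner p q) / 2"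
  using assms by (simp add: chord_overlap_def dot_norm_neg[of p q] field_simps)

lemma sphere_point_in_sphere:
  assumes "x \<in> space base" shows "sphere_point x \<in> sphere 0 1"
proof -
  obtain u t where x: "x = (u, t)" and u: "0 \<le> u" "u \<le> 1"
    using assms by (auto simp: space_base)
  define a b where "a = sqrt u" and "b = sqrt (1 - u)"
  have sq: "a\<^sup>2 = u" "b\<^sup>2 = 1 - u" using u by (simp_all add: a_def b_def)
  define C S where "C = cos (2 * pi * t)" and "S = sin (2 * pi * t)"
  have CS: "S\<^sup>2 + C\<^sup>2 = 1" by (simp add: C_def S_def)
  have "inner (sphere_point x) (sphere_point x) =
      4 * (a\<^sup>2 * b\<^sup>2) * (S\<^sup>2 + C\<^sup>2) + (1 - 2 * u)\<^sup>2"
    unfolding inner_vec_def sum_3 sphere_point_def x a_def b_def C_def S_def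
    unfolding a_def[symmetric] b_def[symmetric] C_def[symmetric] S_def[symmetric]
    by (simp add: a_def[symmetric] b_def[symmetric] C_def[symmetric] S_def[symmetric])
      (simp add: power2_eq_square algebra_simps)
  also have "\<dots> = 1"
    unfolding sq CS by (simp add: power2_eq_square algebra_simps)
  finally show ?thesis by (simp add: norm_eq_1)
qed

text \<open>Both sides equal (1 + <p, q>)/2. In coordinates, the longitudes enter only through their
  difference, and the squares of its sine and cosine combine to 1.\<close>

lemma overlap_sphere_point:
  assumes "x \<in> space base" "y \<in> space base"
  shows "overlap x y = chord_overlap (sphere_point x) (sphere_point y)"
proof -
  obtain u t where x: "x = (u, t)" and u: "0 \<le> u" "u \<le> 1"
    using assms by (auto simp: space_base)
  obtain u' t' where y: "y = (u', t')" and u': "0 \<le> u'" "u' \<le> 1"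
    using assms by (auto simp: space_base)
  define a b c d where "a = sqrt u" and "b = sqrt (1 - u)" and "c = sqrt u'" and "d = sqrt (1 - u')"
  have sq: "a\<^sup>2 = u" "b\<^sup>2 = 1 - u" "c\<^sup>2 = u'" "d\<^sup>2 = 1 - u'"
    using u u' by (simp_all add: a_def b_def c_def d_def)
  define C S where "C = cos (2 * pi * t - 2 * pi * t')" and "S = sin (2 * pi * t - 2 * pi * t')"
  have CS: "C\<^sup>2 + S\<^sup>2 = 1" by (simp add: C_def S_def)
  have "herm x y = Complex (a * c * C + b * d) (a * c * S)"
    unfolding herm_def spin1_def spin2_def x y a_def b_def c_def d_def C_def S_def
    by (simp add: complex_eq_iff cos_diff sin_diff algebra_simps)
  then have "overlap x y = (a * c * C + b * d)\<^sup>2 + (a * c * S)\<^sup>2"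
    by (simp add: overlap_def cmod_power2)
  also have "\<dots> = a\<^sup>2 * c\<^sup>2 * (C\<^sup>2 + S\<^sup>2) + b\<^sup>2 * d\<^sup>2 + 2 * a * b * c * d * C"
    by (simp add: power2_eq_square algebra_simps)
  also have "\<dots> = u * u' + (1 - u) * (1 - u') + 2 * a * b * c * d * C"
    unfolding sq CS by simp
  also have "\<dots> = (1 + inner (sphere_point x) (sphere_point y)) / 2"
    unfolding inner_vec_def sum_3 sphere_point_def x y a_def[symmetric] b_def[symmetric] C_def cos_diff
    by (simp add: c_def[symmetric] d_def[symmetric] a_def[symmetric] b_def[symmetric] field_simps)
  also have "\<dots> = chord_overlap (sphere_point x) (sphere_point y)"
    by (simp only: chord_overlap_inner[OF sphere_point_in_sphere[OF assms(1)] sphere_point_in_sphere[OF assms(2)]])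
  finally show ?thesis .
qed

section \<open>Compactness: one configuration for all truncations\<close>

definition pair_sum :: "nat \<Rightarrow> (nat \<Rightarrow> nat \<Rightarrow> real) \<Rightarrow> real" where
  "pair_sum n f = (\<Sum>i<n. \<Sum>j\<in>{..<n} - {i}. f i j)"

lemma pair_sum_mono:
  "(\<And>i j. i < n \<Longrightarrow> j < n \<Longrightarrow> i \<noteq> j \<Longrightarrow> f i j \<le> g i j) \<Longrightarrow> pair_sum n f \<le> pair_sum n g"
  unfolding pair_sum_def by (intro sum_mono) auto

lemma pair_sum_cong:
  "(\<And>i j. i < n \<Longrightarrow> j < n \<Longrightarrow> i \<noteq> j \<Longrightarrow> f i j = g i j) \<Longrightarrow> pair_sum n f = pair_sum n g"
  unfolding pair_sum_def by (intro sum.cong) auto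

text \<open>Tychonoff's theorem. Configurations are indexed by all natural numbers, so that they
  form a full product in the topology of the function type.\<close>

lemma compact_sphere_product: "compact (Pi UNIV (\<lambda>_::nat. sphere (0::real^3) 1))"
proof -
  have "compactin (product_topology (\<lambda>_::nat. euclidean) UNIV) (PiE UNIV (\<lambda>_. sphere (0::real^3) 1))"
    unfolding compactin_PiE by simp
  then show ?thesis
    by (simp add: euclidean_product_topology PiE_UNIV_domain Pi_def)
qed

lemma exists_sphere_points_polynomial_energy_le:
  assumes "n > 0"
  shows "\<exists>p. (\<forall>i. p i \<in> sphere 0 1) \<and>
     pair_sum n (\<lambda>i j. \<Sum>m\<le>N. c m * chord_overlap (p i) (p j) ^ m)
     \<le> real n ^ 2 * (\<Sum>m\<le>N. c m * (1 / real (m + 1) - 1 / real (m + n)))"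
proof -
  obtain x where x: "x \<in> conf_space n" and
    le: "(\<Sum>i<n. \<Sum>j\<in>{..<n} - {i}. \<Sum>m<Suc N. c m * overlap (x i) (x j) ^ m)
     \<le> real n ^ 2 * (\<Sum>m<Suc N. c m * (1 / real (m + 1) - 1 / real (m + n)))"
    using exists_conf_polynomial_energy_le[OF assms, of c "Suc N"] by blast
  \<comment> \<open>Indices from n on repeat the point of index 0, which exists because n > 0, so
    that every coordinate lies on the sphere.\<close>
  define p where "p i = (if i < n then sphere_point (x i) else sphere_point (x 0))" for i
  have xs: "x i \<in> space base" if "i < n" for i using x that by (simp add: conf_space_def)
  have "\<forall>i. p i \<in> sphere 0 1"
    using xs sphere_point_in_sphere assms by (auto simp: p_def simp del: mem_sphere)
  moreover have "pair_sum n (\<lambda>i j. \<Sum>m\<le>N. c m * chord_overlap (p i) (p j) ^ m) =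
      pair_sum n (\<lambda>i j. \<Sum>m<Suc N. c m * overlap (x i) (x j) ^ m)"
    unfolding lessThan_Suc_atMost
    by (intro pair_sum_cong sum.cong refl) (simp add: p_def overlap_sphere_point xs)
  ultimately show ?thesis
    using le unfolding pair_sum_def[symmetric] lessThan_Suc_atMost by (intro exI[of _ p]) simp
qed

text \<open>Raising the truncation adds only terms with m > 0, which are nonnegative on the sphere.
  The closed sublevel sets therefore decrease, each meets the compact product, and so does their
  intersection.\<close>

lemma exists_sphere_points_partial_energies_le:
  assumes "n > 0"
    and c: "\<And>m. m > 0 \<Longrightarrow> c m \<ge> 0"
    and C: "\<And>N. real n ^ 2 * (\<Sum>m\<le>N. c m * (1 / real (m + 1) - 1 / real (m + n))) \<le> C"
  shows "\<exists>p. (\<forall>i. p i \<in> sphere 0 1) \<and>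
     (\<forall>N. pair_sum n (\<lambda>i j. \<Sum>m\<le>N. c m * chord_overlap (p i) (p j) ^ m) \<le> C)"
proof -
  define F where "F N p = pair_sum n (\<lambda>i j. \<Sum>m\<le>N. c m * chord_overlap (p i) (p j) ^ m)"
    for N and p :: "nat \<Rightarrow> real^3"
  define A where "A N = {p. F N p \<le> C}" for N
  define K where "K = Pi UNIV (\<lambda>_::nat. sphere (0::real^3) 1)"
  have closed: "closed (A N)" for N
  proof -
    have "continuous_on UNIV (F N)"
      unfolding F_def pair_sum_def chord_overlap_def
      by (intro continuous_intros continuous_on_product_coordinates) simp
    then show ?thesis unfolding A_def by (intro closed_Collect_le continuous_on_const)
  qed
  have mono: "F N p \<le> F N' p" if "p \<in> K" "N \<le> N'" for N N' p
    unfolding F_def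
  proof (intro pair_sum_mono sum_mono2)
    fix i j m
    have "0 \<le> chord_overlap (p i) (p j)"
      using that(1) by (intro chord_overlap_bounds) (auto simp: K_def)
    then show "m \<in> {..N'} - {..N} \<Longrightarrow> 0 \<le> c m * chord_overlap (p i) (p j) ^ m"
      using c by auto
  qed (use that in auto)
  have "K \<inter> \<Inter>(range A) \<noteq> {}"
  proof (rule compact_fip[THEN iffD1, rule_format])
    show "compact K" unfolding K_def by (rule compact_sphere_product)
    fix B assume B: "B \<subseteq> range A" "finite B"
    then obtain I where I: "finite I" "B = A ` I" by (meson finite_subset_image)
    \<comment> \<open>For empty \<open>I\<close> the value of \<open>M\<close> is unspecified; any
      value then yields a point of \<open>K\<close>, which is all that is required.\<close>
    define M where "M = Max I"
    have M: "N \<le> M" if "N \<in> I" for N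
      using that I(1) by (simp add: M_def)
    from exists_sphere_points_polynomial_energy_le[OF assms(1), where N = M and c = c]
    obtain p where p: "\<forall>i. p i \<in> sphere 0 1"
      and FM: "F M p \<le> real n ^ 2 * (\<Sum>m\<le>M. c m * (1 / real (m + 1) - 1 / real (m + n)))"
      unfolding F_def by (elim exE conjE)
    have le: "F M p \<le> C" using FM C[of M] by (rule order_trans)
    have pK: "p \<in> K" using p by (auto simp: K_def)
    moreover have "p \<in> A N" if "N \<in> I" for N
      using mono[OF pK M[OF that]] le by (simp add: A_def)
    ultimately show "K \<inter> \<Inter>B \<noteq> {}" using I by blast
  qed (use closed in auto)
  then obtain p where "p \<in> K" "\<And>N. p \<in> A N" by auto
  then show ?thesis
    by (intro exI[of _ p]) (auto simp: K_def A_def F_def)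
qed

section \<open>The binomial series of the Riesz kernel\<close>

text \<open>The factor \<open>sgn a\<close> makes every coefficient except the constant one nonnegative.\<close>

definition binomial_coeff :: "real \<Rightarrow> nat \<Rightarrow> real" where
  "binomial_coeff a m = sgn a * pochhammer a m / fact m"

text \<open>Splitting off the first factor of the Pochhammer symbol leaves factors a + 1, a + 2,
  ..., all positive, while \<open>sgn a * a\<close> is the absolute value of a.\<close>

lemma binomial_coeff_nonneg:
  assumes "a > -1" "m > 0" shows "binomial_coeff a m \<ge> 0"
proof -
  obtain k where m: "m = Suc k" using assms(2) gr0_implies_Suc by blast
  have p: "pochhammer (a + 1) k \<ge> 0" using assms(1) by (intro pochhammer_nonneg) auto
  have s: "sgn a * a \<ge> 0" by (simp add: sgn_real_def)
  have "(sgn a * a) * pochhammer (a + 1) k \<ge> 0" by (rule mult_nonneg_nonneg[OF s p])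
  moreover have "binomial_coeff a m = (sgn a * a) * pochhammer (a + 1) k / fact m"
    by (simp add: m binomial_coeff_def pochhammer_rec)
  ultimately show ?thesis
    using fact_ge_zero[of m, where 'a = real] by (metis divide_nonneg_nonneg)
qed

lemma binomial_coeff_sums:
  assumes "0 \<le> z" "z < 1"
  shows "(\<lambda>m. binomial_coeff a m * z ^ m) sums (sgn a * (1 - z) powr (- a))"
proof -
  have "(\<lambda>m. ((- a) gchoose m) * (- z) ^ m) sums (1 + (- z)) powr (- a)"
    using assms by (intro gen_binomial_real) auto
  then have "(\<lambda>m. sgn a * (((- a) gchoose m) * (- z) ^ m)) sums (sgn a * (1 - z) powr (- a))"
    by (intro sums_mult) simp
  also have "(\<lambda>m. sgn a * (((- a) gchoose m) * (- z) ^ m)) = (\<lambda>m. binomial_coeff a m * z ^ m)"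
  proof
    fix m
    \<comment> \<open>One alternating sign comes from rewriting the generalised binomial
      coefficient, the other from the argument -z; they cancel.\<close>
    have "(- 1) ^ m * (- 1) ^ m = (1::real)" by (simp flip: power_mult_distrib)
    then show "sgn a * (((- a) gchoose m) * (- z) ^ m) = binomial_coeff a m * z ^ m"
      by (simp add: gbinomial_pochhammer binomial_coeff_def power_minus[of z])
  qed
  finally show ?thesis .
qed

text \<open>The omitted tail has only indices m > 0, so it is nonnegative even when the constant
  coefficient is -1.\<close>

lemma binomial_coeff_partial_le:
  assumes "a > -1" "0 \<le> z" "z < 1"
  shows "(\<Sum>m\<le>N. binomial_coeff a m * z ^ m) \<le> sgn a * (1 - z) powr (- a)"
proof -
  have "(\<Sum>m\<le>N. binomial_coeff a m * z ^ m) \<le> (\<Sum>m. binomial_coeff a m * z ^ m)"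
    using binomial_coeff_sums[OF assms(2,3), of a] assms binomial_coeff_nonneg[OF assms(1)]
    by (intro sum_le_suminf) (auto simp: sums_iff)
  then show ?thesis
    using binomial_coeff_sums[OF assms(2,3), of a] by (simp add: sums_iff)
qed

text \<open>The factor \<open>r < 1\<close> keeps the series convergent at coinciding points, where \<open>z = 1\<close>.\<close>

lemma exists_sphere_points_regularized_energy_le:
  assumes "n > 0" and a: "a > -1"
    and I: "((\<lambda>z. sgn a * (1 - z) powr (- a) * (1 - z ^ (n - 1))) has_integral I) {0..1}"
  shows "\<exists>p. (\<forall>i. p i \<in> sphere 0 1) \<and> (\<forall>r. 0 < r \<and> r < 1 \<longrightarrow>
     pair_sum n (\<lambda>i j. sgn a * (1 - r * chord_overlap (p i) (p j)) powr (- a)) \<le> real n ^ 2 * I)"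
proof -
  let ?c = "binomial_coeff a"
  \<comment> \<open>Partial sums lie below the full kernel and \<open>1 - z ^ (n - 1)\<close> is
    nonnegative, so comparing integrals bounds all truncations at once, without exchanging a series
    with an integral. At z = 1 both integrands are 0.\<close>
  have "(\<Sum>m\<le>N. ?c m * (1 / real (m + 1) - 1 / real (m + n))) \<le> I" for N
  proof (rule has_integral_le[OF _ I])
    have pw: "((\<lambda>z. z ^ m) has_integral 1 / real (m + 1)) {0..1}" for m
      using has_integral_Beta_nat[of m 0] by simp
    have "((\<lambda>z. \<Sum>m\<le>N. ?c m * (z ^ m - z ^ (m + (n - 1)))) has_integral
        (\<Sum>m\<le>N. ?c m * (1 / real (m + 1) - 1 / real (m + (n - 1) + 1)))) {0..1}"
      by (intro has_integral_sum has_integral_mult_right has_integral_diff pw) auto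
    then show "((\<lambda>z. (\<Sum>m\<le>N. ?c m * z ^ m) * (1 - z ^ (n - 1))) has_integral
        (\<Sum>m\<le>N. ?c m * (1 / real (m + 1) - 1 / real (m + n)))) {0..1}"
      using assms(1) by (cases n) (simp_all add: sum_distrib_left sum_distrib_right algebra_simps power_add)
    fix z :: real assume z: "z \<in> {0..1}"
    show "(\<Sum>m\<le>N. ?c m * z ^ m) * (1 - z ^ (n - 1)) \<le> sgn a * (1 - z) powr (- a) * (1 - z ^ (n - 1))"
    proof (cases "z = 1")
      case False
      with z show ?thesis
        by (intro mult_right_mono binomial_coeff_partial_le a) (auto intro: power_le_one)
    qed simp
  qed
  then have bound: "real n ^ 2 * (\<Sum>m\<le>N. ?c m * (1 / real (m + 1) - 1 / real (m + n))) \<le> real n ^ 2 * I" for N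
    by (intro mult_left_mono) auto
  have "\<exists>p. (\<forall>i. p i \<in> sphere 0 1) \<and>
      (\<forall>N. pair_sum n (\<lambda>i j. \<Sum>m\<le>N. ?c m * chord_overlap (p i) (p j) ^ m) \<le> real n ^ 2 * I)"
    by (rule exists_sphere_points_partial_energies_le[OF assms(1) _ bound])
       (rule binomial_coeff_nonneg[OF a])
  then obtain p where p: "\<forall>i. p i \<in> sphere 0 1"
    and le: "\<forall>N. pair_sum n (\<lambda>i j. \<Sum>m\<le>N. ?c m * chord_overlap (p i) (p j) ^ m) \<le> real n ^ 2 * I"
    by (elim exE conjE)
  have "pair_sum n (\<lambda>i j. sgn a * (1 - r * chord_overlap (p i) (p j)) powr (- a)) \<le> real n ^ 2 * I"
    if r: "0 < r" "r < 1" for r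
  proof (rule LIMSEQ_le_const2)
    have z: "0 \<le> r * chord_overlap (p i) (p j)" "r * chord_overlap (p i) (p j) < 1" for i j
    proof -
      have b: "0 \<le> chord_overlap (p i) (p j)" "chord_overlap (p i) (p j) \<le> 1"
        using p chord_overlap_bounds by blast+
      then show "0 \<le> r * chord_overlap (p i) (p j)" using r by simp
      have "r * chord_overlap (p i) (p j) \<le> r" using b r by (simp add: mult_left_le)
      then show "r * chord_overlap (p i) (p j) < 1" using r by linarith
    qed
    show "(\<lambda>N. pair_sum n (\<lambda>i j. \<Sum>m\<le>N. ?c m * (r * chord_overlap (p i) (p j)) ^ m)) \<longlonglongrightarrow>
       pair_sum n (\<lambda>i j. sgn a * (1 - r * chord_overlap (p i) (p j)) powr (- a))"
      unfolding pair_sum_def using binomial_coeff_sums[OF z]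
      by (intro tendsto_sum) (simp add: sums_def_le)
    \<comment> \<open>Shrinking z to r z lowers every term with m > 0 and leaves the constant term,
      whatever its sign, unchanged.\<close>
    have "pair_sum n (\<lambda>i j. \<Sum>m\<le>N. ?c m * (r * chord_overlap (p i) (p j)) ^ m) \<le>
        pair_sum n (\<lambda>i j. \<Sum>m\<le>N. ?c m * chord_overlap (p i) (p j) ^ m)" for N
    proof (intro pair_sum_mono sum_mono)
      fix i j m
      have b: "0 \<le> chord_overlap (p i) (p j)" using p chord_overlap_bounds by blast
      show "?c m * (r * chord_overlap (p i) (p j)) ^ m \<le> ?c m * chord_overlap (p i) (p j) ^ m"
      proof (cases "m = 0")
        case False
        have "(r * chord_overlap (p i) (p j)) ^ m \<le> chord_overlap (p i) (p j) ^ m"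
          using r b z by (intro power_mono) (auto simp: mult_left_le_one_le)
        then show ?thesis using False binomial_coeff_nonneg[OF a] by (intro mult_left_mono) auto
      qed simp
    qed
    then show "\<exists>N. \<forall>k\<ge>N. pair_sum n (\<lambda>i j. \<Sum>m\<le>k. ?c m * (r * chord_overlap (p i) (p j)) ^ m) \<le> real n ^ 2 * I"
      using le by (meson order_trans)
  qed
  with p show ?thesis by blast
qed

section \<open>From partial sums to the Riesz energy\<close>

lemma pair_sum_tendsto:
  "(\<And>i j. i < n \<Longrightarrow> j < n \<Longrightarrow> i \<noteq> j \<Longrightarrow> ((\<lambda>r. f r i j) \<longlongrightarrow> g i j) F) \<Longrightarrow>
    ((\<lambda>r. pair_sum n (f r)) \<longlongrightarrow> pair_sum n g) F"
  unfolding pair_sum_def by (intro tendsto_sum) auto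

text \<open>Here the exponent -a is positive, so the kernel is continuous down to distance 0 and r
  can tend to 1 even at coinciding points.\<close>

lemma exists_sphere_points_energy_le_neg:
  assumes "n > 0" and a: "-1 < a" "a < 0"
    and I: "((\<lambda>z. sgn a * (1 - z) powr (- a) * (1 - z ^ (n - 1))) has_integral I) {0..1}"
  shows "\<exists>p. (\<forall>i. p i \<in> sphere 0 1) \<and>
     pair_sum n (\<lambda>i j. sgn a * (1 - chord_overlap (p i) (p j)) powr (- a)) \<le> real n ^ 2 * I"
proof -
  obtain p where p: "\<forall>i. p i \<in> sphere 0 1"
    and le: "\<And>r. 0 < r \<Longrightarrow> r < 1 \<Longrightarrow>
     pair_sum n (\<lambda>i j. sgn a * (1 - r * chord_overlap (p i) (p j)) powr (- a)) \<le> real n ^ 2 * I"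
    using exists_sphere_points_regularized_energy_le[OF assms(1) a(1) I] by blast
  have ev: "eventually (\<lambda>r::real. 0 < r \<and> r < 1) (at_left 1)"
    using eventually_at_left_real[of 0 "1::real"] by simp
  have "pair_sum n (\<lambda>i j. sgn a * (1 - chord_overlap (p i) (p j)) powr (- a)) \<le> real n ^ 2 * I"
  proof (rule tendsto_upperbound)
    show "((\<lambda>r. pair_sum n (\<lambda>i j. sgn a * (1 - r * chord_overlap (p i) (p j)) powr (- a))) \<longlongrightarrow>
        pair_sum n (\<lambda>i j. sgn a * (1 - chord_overlap (p i) (p j)) powr (- a))) (at_left 1)"
    proof (rule pair_sum_tendsto)
      fix i j
      have b: "0 \<le> chord_overlap (p i) (p j)" "chord_overlap (p i) (p j) \<le> 1"
        using p chord_overlap_bounds by blast+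
      have "((\<lambda>r. (1 - r * chord_overlap (p i) (p j)) powr (- a)) \<longlongrightarrow>
        (1 - 1 * chord_overlap (p i) (p j)) powr (- a)) (at_left 1)"
      proof (rule tendsto_powr')
        \<comment> \<open>When the limit of the base is 0, continuity of \<open>powr\<close> also
          requires the base to be nonnegative along the way.\<close>
        have "0 \<le> 1 - r * chord_overlap (p i) (p j)" if "0 < r \<and> r < 1" for r
          using mult_le_one[of r "chord_overlap (p i) (p j)"] b that by simp
        then have "eventually (\<lambda>r. 0 \<le> 1 - r * chord_overlap (p i) (p j)) (at_left 1)"
          by (rule eventually_mono[OF ev])
        then show "1 - 1 * chord_overlap (p i) (p j) \<noteq> 0 \<or>
            0 < - a \<and> eventually (\<lambda>r. 0 \<le> 1 - r * chord_overlap (p i) (p j)) (at_left 1)"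
          using a by simp
      qed (intro tendsto_intros)+
      then show "((\<lambda>r. sgn a * (1 - r * chord_overlap (p i) (p j)) powr (- a)) \<longlongrightarrow>
        sgn a * (1 - chord_overlap (p i) (p j)) powr (- a)) (at_left 1)"
        by (intro tendsto_mult_left) simp
    qed
    show "eventually (\<lambda>r. pair_sum n (\<lambda>i j. sgn a * (1 - r * chord_overlap (p i) (p j)) powr (- a))
        \<le> real n ^ 2 * I) (at_left 1)"
      by (rule eventually_mono[OF ev]) (use le in blast)
  qed simp
  with p show ?thesis by blast
qed

text \<open>A coincidence would contribute (1 - r)^(-a), which is unbounded as r tends to 1. It has
  to be excluded before the limit, since at r = 1 the convention \<open>0 powr (- a) = 0\<close>
  would hide it.\<close>

lemma exists_sphere_points_energy_le_pos:
  assumes "n > 0" and a: "0 < a"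
    and I: "((\<lambda>z. (1 - z) powr (- a) * (1 - z ^ (n - 1))) has_integral I) {0..1}"
  shows "\<exists>p. (\<forall>i. p i \<in> sphere 0 1) \<and> (\<forall>i<n. \<forall>j<n. i \<noteq> j \<longrightarrow> p i \<noteq> p j) \<and>
     pair_sum n (\<lambda>i j. (1 - chord_overlap (p i) (p j)) powr (- a)) \<le> real n ^ 2 * I"
proof -
  have "\<exists>p. (\<forall>i. p i \<in> sphere 0 1) \<and> (\<forall>r. 0 < r \<and> r < 1 \<longrightarrow>
     pair_sum n (\<lambda>i j. sgn a * (1 - r * chord_overlap (p i) (p j)) powr (- a)) \<le> real n ^ 2 * I)"
    using a I by (intro exists_sphere_points_regularized_energy_le[OF assms(1)]) auto
  then obtain p where p: "\<forall>i. p i \<in> sphere 0 1"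
    and le: "\<And>r. 0 < r \<Longrightarrow> r < 1 \<Longrightarrow>
     pair_sum n (\<lambda>i j. (1 - r * chord_overlap (p i) (p j)) powr (- a)) \<le> real n ^ 2 * I"
    using a by auto
  have ev: "eventually (\<lambda>r::real. 0 < r \<and> r < 1) (at_left 1)"
    using eventually_at_left_real[of 0 "1::real"] by simp
  have distinct: "p i \<noteq> p j" if ij: "i < n" "j < n" "i \<noteq> j" for i j
  proof
    assume "p i = p j"
    then have one: "chord_overlap (p i) (p j) = 1" by (simp add: chord_overlap_def)
    \<comment> \<open>\<open>D\<close> exceeds the energy bound, and at r = 1 - e a coinciding pair
      alone contributes e^(-a) = D. The maximum with 1 ensures e < 1.\<close>
    define D where "D = max (real n ^ 2 * I) 1 + 1"
    define e where "e = D powr (- (1 / a))"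
    have D: "D > 1" "D > real n ^ 2 * I" by (auto simp: D_def)
    have e: "0 < e" "e < 1" using D(1) a by (auto simp: e_def intro: powr_less_one)
    have "D = e powr (- a)" using D(1) a by (simp add: e_def powr_powr)
    also have "\<dots> \<le> (\<Sum>j\<in>{..<n} - {i}. (1 - (1 - e) * chord_overlap (p i) (p j)) powr (- a))"
      using ij one member_le_sum[of j "{..<n} - {i}" "\<lambda>j. (1 - (1 - e) * chord_overlap (p i) (p j)) powr (- a)"]
      by simp
    also have "\<dots> \<le> pair_sum n (\<lambda>i j. (1 - (1 - e) * chord_overlap (p i) (p j)) powr (- a))"
      unfolding pair_sum_def using ij(1)
      by (intro member_le_sum[of i "{..<n}" "\<lambda>i. \<Sum>j\<in>{..<n} - {i}. (1 - (1 - e) * chord_overlap (p i) (p j)) powr (- a)"])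
         (auto intro: sum_nonneg)
    also have "\<dots> \<le> real n ^ 2 * I" using e by (intro le) auto
    finally show False using D(2) by simp
  qed
  have "pair_sum n (\<lambda>i j. (1 - chord_overlap (p i) (p j)) powr (- a)) \<le> real n ^ 2 * I"
  proof (rule tendsto_upperbound)
    show "((\<lambda>r. pair_sum n (\<lambda>i j. (1 - r * chord_overlap (p i) (p j)) powr (- a))) \<longlongrightarrow>
        pair_sum n (\<lambda>i j. (1 - chord_overlap (p i) (p j)) powr (- a))) (at_left 1)"
    proof (rule pair_sum_tendsto)
      fix i j assume "i < n" "j < n" "i \<noteq> j"
      then have "1 - 1 * chord_overlap (p i) (p j) \<noteq> 0"
        using distinct by (simp add: chord_overlap_def)
      then have "((\<lambda>r. (1 - r * chord_overlap (p i) (p j)) powr (- a)) \<longlongrightarrow>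
        (1 - 1 * chord_overlap (p i) (p j)) powr (- a)) (at_left 1)"
        by (intro tendsto_powr tendsto_diff tendsto_mult tendsto_const tendsto_ident_at) auto
      then show "((\<lambda>r. (1 - r * chord_overlap (p i) (p j)) powr (- a)) \<longlongrightarrow>
        (1 - chord_overlap (p i) (p j)) powr (- a)) (at_left 1)"
        by simp
    qed
    show "eventually (\<lambda>r. pair_sum n (\<lambda>i j. (1 - r * chord_overlap (p i) (p j)) powr (- a))
        \<le> real n ^ 2 * I) (at_left 1)"
      by (rule eventually_mono[OF ev]) (use le in blast)
  qed simp
  with p distinct show ?thesis by blast
qed

section \<open>Attained optima of the Riesz energy\<close>

text \<open>The squared distance is 4 (1 - z), which explains both the factor 2^(-s) and the
  exponent a = s/2. For p = q both sides are 0, since \<open>powr\<close> vanishes at base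
  0.\<close>

lemma norm_powr_chord_overlap:
  "norm (p - q) powr (- s) = 2 powr (- s) * (1 - chord_overlap p q) powr (- (s / 2))"
proof (cases "p = q")
  case False
  then have pos: "norm (p - q) / 2 > 0" by simp
  have "1 - chord_overlap p q = (norm (p - q) / 2) powr 2"
    using pos by (simp add: chord_overlap_def power_divide)
  then have "(1 - chord_overlap p q) powr (- (s / 2)) = (norm (p - q) / 2) powr (- s)"
    by (simp only: powr_powr) simp
  then show ?thesis
    by (simp add: powr_divide)
qed (simp add: chord_overlap_def)

lemma riesz_energy_eq_sum:
  "riesz_energy s n x = (\<Sum>i<n. \<Sum>j\<in>{..<n} - {i}. riesz_kernel s (x i) (x j))"
proof -
  have "{(i, j). i < n \<and> j < n \<and> i \<noteq> j} = (SIGMA i:{..<n}. {..<n} - {i})" by auto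
  then show ?thesis by (simp add: riesz_energy_def sum.Sigma)
qed

lemma riesz_energy_eq_pair_sum:
  assumes "s \<noteq> 0" and "s > 0 \<Longrightarrow> \<forall>i<n. \<forall>j<n. i \<noteq> j \<longrightarrow> x i \<noteq> x j"
  shows "riesz_energy s n x =
    ereal (2 powr (- s) * pair_sum n (\<lambda>i j. (1 - chord_overlap (x i) (x j)) powr (- (s / 2))))"
proof -
  have "riesz_energy s n x = (\<Sum>i<n. \<Sum>j\<in>{..<n} - {i}. ereal (norm (x i - x j) powr (- s)))"
    unfolding riesz_energy_eq_sum using assms
    by (intro sum.cong refl) (auto simp: riesz_kernel_def)
  then show ?thesis
    by (simp add: sum_ereal norm_powr_chord_overlap pair_sum_def sum_distrib_left)
qed

definition sphere_confs :: "(nat \<Rightarrow> real^3) set" where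
  "sphere_confs = Pi UNIV (\<lambda>_. sphere 0 1)"

lemma sphere_confs_compact: "compact sphere_confs"
  unfolding sphere_confs_def by (rule compact_sphere_product)

lemma sphere_confs_nonempty: "sphere_confs \<noteq> {}"
proof -
  have "(\<lambda>_. axis 1 1) \<in> sphere_confs" by (simp add: sphere_confs_def)
  then show ?thesis by blast
qed

text \<open>Padding with the point of index 0 replaces configurations that are arbitrary beyond n by
  members of a compact set, with the same energies.\<close>

lemma sphere_energies_eq_image:
  assumes "n > 0"
  shows "sphere_energies s n = riesz_energy s n ` sphere_confs"
proof (intro set_eqI iffI)
  fix e assume "e \<in> sphere_energies s n"
  then obtain x where x: "e = riesz_energy s n x" "\<forall>i<n. x i \<in> sphere 0 1"
    by (auto simp: sphere_energies_def)
  define y where "y i = (if i < n then x i else x 0)" for i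
  have "y \<in> sphere_confs" using x(2) assms by (auto simp: y_def sphere_confs_def)
  moreover have "riesz_energy s n y = riesz_energy s n x"
    unfolding riesz_energy_eq_sum by (intro sum.cong refl) (auto simp: y_def)
  ultimately show "e \<in> riesz_energy s n ` sphere_confs" using x(1) by (metis image_eqI)
next
  fix e assume "e \<in> riesz_energy s n ` sphere_confs"
  then show "e \<in> sphere_energies s n"
    by (fastforce simp: sphere_energies_def sphere_confs_def Pi_def simp del: mem_sphere)
qed

text \<open>Extended-real addition fails to be continuous only where infinities of opposite sign
  meet; nonnegativity excludes this.\<close>

lemma continuous_on_sum_ereal_nonneg:
  fixes f :: "'i \<Rightarrow> 'a::topological_space \<Rightarrow> ereal"
  assumes "\<And>i. i \<in> I \<Longrightarrow> continuous_on S (f i)" "\<And>i x. i \<in> I \<Longrightarrow> x \<in> S \<Longrightarrow> f i x \<ge> 0"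
  shows "continuous_on S (\<lambda>x. \<Sum>i\<in>I. f i x)"
  using assms
proof (induction I rule: infinite_finite_induct)
  case (insert i I)
  have "(\<Sum>i\<in>I. f i x) \<ge> 0" if "x \<in> S" for x
    using insert.prems that by (intro sum_nonneg) auto
  moreover have "f i x \<ge> 0" if "x \<in> S" for x using insert.prems that by auto
  moreover have "continuous_on S (\<lambda>x. \<Sum>i\<in>I. f i x)" "continuous_on S (f i)"
    using insert by auto
  ultimately have "continuous_on S (\<lambda>x. f i x + (\<Sum>i\<in>I. f i x))"
    unfolding continuous_on_def by (fastforce intro!: tendsto_add_ereal_nonneg)
  then show ?case using insert.hyps by simp
qed auto

lemma continuous_on_riesz_energy:
  assumes "s \<noteq> 0"
  shows "continuous_on sphere_confs (riesz_energy s n)"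
proof -
  have coord: "continuous_on sphere_confs (\<lambda>x. x i)" for i
    by (rule continuous_on_subset[OF continuous_on_product_coordinates]) simp
  have "continuous_on sphere_confs (\<lambda>x. riesz_kernel s (x i) (x j))" for i j
  proof (cases "s > 0")
    case True
    have "continuous_on sphere_confs (\<lambda>x. norm (x i - x j) powr s)"
      using True by (intro continuous_on_powr' continuous_intros coord) auto
    then have "continuous_on sphere_confs (\<lambda>x. inverse (ereal (norm (x i - x j) powr s)))"
      by (intro continuous_on_compose2[OF continuous_on_inverse_ereal] continuous_on_ereal) auto
    \<comment> \<open>In the extended reals \<open>inverse 0 = \<infinity>\<close>, which is the
      value of the kernel at coinciding points, and inversion is continuous on the nonnegative
      half-line.\<close>
    moreover have "riesz_kernel s p q = inverse (ereal (norm (p - q) powr s))" for p q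
      using True by (auto simp: riesz_kernel_def powr_minus)
    ultimately show ?thesis by simp
  next
    case False
    have "continuous_on sphere_confs (\<lambda>x. norm (x i - x j) powr (- s))"
      using False assms by (intro continuous_on_powr' continuous_intros coord) auto
    then have "continuous_on sphere_confs (\<lambda>x. ereal (norm (x i - x j) powr (- s)))"
      by (rule continuous_on_ereal)
    then show ?thesis using False assms by (simp add: riesz_kernel_def)
  qed
  moreover have "riesz_kernel s p q \<ge> 0" for p q
    by (simp add: riesz_kernel_def)
  ultimately show ?thesis
    unfolding riesz_energy_eq_sum[abs_def]
    by (intro continuous_on_sum_ereal_nonneg sum_nonneg) auto
qed

text \<open>\<open>LEAST\<close> is informative only once a minimum exists; it does, as the
  extended-valued energy is continuous on a compact set.\<close>

lemma optimal_riesz_energy_le: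
  assumes "n > 0" "s > 0" "x \<in> sphere_confs"
  shows "optimal_riesz_energy s n \<le> riesz_energy s n x"
proof -
  obtain y where y: "y \<in> sphere_confs" "\<And>x. x \<in> sphere_confs \<Longrightarrow> riesz_energy s n y \<le> riesz_energy s n x"
    using continuous_attains_inf[OF sphere_confs_compact sphere_confs_nonempty continuous_on_riesz_energy, of s n]
      assms(2) by auto
  have "optimal_riesz_energy s n = (LEAST e. e \<in> riesz_energy s n ` sphere_confs)"
    using assms by (simp add: optimal_riesz_energy_def sphere_energies_eq_image)
  also have "\<dots> = riesz_energy s n y"
    by (rule Least_equality) (use y in auto)
  finally show ?thesis using y(2)[OF assms(3)] by simp
qed

lemma optimal_riesz_energy_ge:
  assumes "n > 0" "s < 0" "x \<in> sphere_confs"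
  shows "optimal_riesz_energy s n \<ge> riesz_energy s n x"
proof -
  obtain y where y: "y \<in> sphere_confs" "\<And>x. x \<in> sphere_confs \<Longrightarrow> riesz_energy s n x \<le> riesz_energy s n y"
    using continuous_attains_sup[OF sphere_confs_compact sphere_confs_nonempty continuous_on_riesz_energy, of s n]
      assms(2) by auto
  have "optimal_riesz_energy s n = (GREATEST e. e \<in> riesz_energy s n ` sphere_confs)"
    using assms by (simp add: optimal_riesz_energy_def sphere_energies_eq_image)
  also have "\<dots> = riesz_energy s n y"
    by (rule Greatest_equality) (use y in auto)
  finally show ?thesis using y(2)[OF assms(3)] by simp
qed

lemma optimal_riesz_energy_le_integral:
  assumes "n > 0" "s > 0"
    and "((\<lambda>z. (1 - z) powr (- (s / 2)) * (1 - z ^ (n - 1))) has_integral I) {0..1}"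
  shows "optimal_riesz_energy s n \<le> ereal (2 powr (- s) * (real n ^ 2 * I))"
proof -
  obtain p where p: "\<forall>i. p i \<in> sphere 0 1" "\<forall>i<n. \<forall>j<n. i \<noteq> j \<longrightarrow> p i \<noteq> p j"
    and le: "pair_sum n (\<lambda>i j. (1 - chord_overlap (p i) (p j)) powr (- (s / 2))) \<le> real n ^ 2 * I"
    using exists_sphere_points_energy_le_pos[OF assms(1) _ assms(3)] assms(2) by auto
  have "optimal_riesz_energy s n \<le> riesz_energy s n p"
    using p assms by (intro optimal_riesz_energy_le) (auto simp: sphere_confs_def)
  also have "\<dots> \<le> ereal (2 powr (- s) * (real n ^ 2 * I))"
    using riesz_energy_eq_pair_sum[of s n p] p(2) assms(2) le by simp
  finally show ?thesis .
qed

text \<open>For s < 0 the factor \<open>sgn (s / 2)\<close> is -1, so an upper bound for the signed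
  sum is a lower bound for the energy to be maximised.\<close>

lemma optimal_riesz_energy_ge_integral:
  assumes "n > 0" "-2 < s" "s < 0"
    and I: "((\<lambda>z. (1 - z) powr (- (s / 2)) * (1 - z ^ (n - 1))) has_integral I) {0..1}"
  shows "optimal_riesz_energy s n \<ge> ereal (2 powr (- s) * (real n ^ 2 * I))"
proof -
  have "\<exists>p. (\<forall>i. p i \<in> sphere 0 1) \<and>
      pair_sum n (\<lambda>i j. sgn (s / 2) * (1 - chord_overlap (p i) (p j)) powr (- (s / 2))) \<le> real n ^ 2 * (- I)"
  proof (rule exists_sphere_points_energy_le_neg[OF assms(1)])
    show "((\<lambda>z. sgn (s / 2) * (1 - z) powr (- (s / 2)) * (1 - z ^ (n - 1))) has_integral - I) {0..1}"
      using has_integral_neg[OF I] assms(3) by simp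
  qed (use assms in auto)
  then obtain p where p: "\<forall>i. p i \<in> sphere 0 1"
    and le: "pair_sum n (\<lambda>i j. (1 - chord_overlap (p i) (p j)) powr (- (s / 2))) \<ge> real n ^ 2 * I"
    using assms(3) by (auto simp: pair_sum_def sum_negf)
  have "ereal (2 powr (- s) * (real n ^ 2 * I)) \<le> riesz_energy s n p"
    using riesz_energy_eq_pair_sum[of s n p] assms(3) le by simp
  also have "\<dots> \<le> optimal_riesz_energy s n"
    using p assms by (intro optimal_riesz_energy_ge) (auto simp: sphere_confs_def)
  finally show ?thesis .
qed

section \<open>The mean-energy integral and its estimates\<close>

text \<open>For a < 1 the two summands converge separately, as Beta integrals with second parameter
  1 - a.\<close>

lemma has_integral_two_point_density:
  fixes a :: real
  assumes "a < 1" "n > 0"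
  shows "((\<lambda>z. (1 - z) powr (- a) * (1 - z ^ (n - 1))) has_integral
    (1 / (1 - a) - Gamma (real n) * Gamma (1 - a) / Gamma (real n + 1 - a))) {0..1}"
proof -
  have "((\<lambda>z. z powr (1 - 1) * (1 - z) powr ((1 - a) - 1) - z powr (real n - 1) * (1 - z) powr ((1 - a) - 1))
      has_integral (Beta 1 (1 - a) - Beta (real n) (1 - a))) {0..1}"
    using assms by (intro has_integral_diff has_integral_Beta_real) auto
  moreover have "Beta 1 (1 - a) = 1 / (1 - a)"
  proof -
    have "1 - a \<notin> \<int>\<^sub>\<le>\<^sub>0" using assms by (auto dest: nonpos_Ints_nonpos)
    then have "Gamma (1 + (1 - a)) = (1 - a) * Gamma (1 - a)"
      using Gamma_plus1[of "1 - a"] by (metis add.commute)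
    moreover have "Gamma (1 - a) > 0" using assms by (intro Gamma_real_pos) auto
    ultimately show ?thesis by (simp add: Beta_def)
  qed
  moreover have "Beta (real n) (1 - a) = Gamma (real n) * Gamma (1 - a) / Gamma (real n + 1 - a)"
    by (simp add: Beta_def add_diff_eq)
  ultimately have "((\<lambda>z. z powr (1 - 1) * (1 - z) powr ((1 - a) - 1) - z powr (real n - 1) * (1 - z) powr ((1 - a) - 1))
      has_integral (1 / (1 - a) - Gamma (real n) * Gamma (1 - a) / Gamma (real n + 1 - a))) {0..1}"
    by simp
  then show ?thesis
  proof (rule has_integral_spike_finite[rotated 2])
    fix z :: real assume z: "z \<in> {0..1} - {0}"
    have "z powr (real n - 1) = z ^ (n - 1)"
      using z assms(2) powr_realpow[of z "n - 1"] by (simp add: of_nat_diff)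
    then show "(1 - z) powr (- a) * (1 - z ^ (n - 1)) =
       z powr (1 - 1) * (1 - z) powr ((1 - a) - 1) - z powr (real n - 1) * (1 - z) powr ((1 - a) - 1)"
      using z by (simp add: algebra_simps)
  qed simp
qed

text \<open>At exponent 1 the Beta integrals diverge, but the quotient of 1 - z^(n-1) by 1 - z is a
  finite geometric sum. At z = 1 the left integrand is 0 by the \<open>powr\<close> convention, so
  that point is discarded.\<close>

lemma has_integral_two_point_density_harm:
  assumes "n > 0"
  shows "((\<lambda>z::real. (1 - z) powr (- 1) * (1 - z ^ (n - 1))) has_integral harm (n - 1)) {0..1}"
proof -
  have "((\<lambda>z::real. \<Sum>k<n - 1. z ^ k) has_integral (\<Sum>k<n - 1. 1 / real (k + 1))) {0..1}"
    using has_integral_Beta_nat[of _ 0] by (intro has_integral_sum) auto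
  moreover have "(\<Sum>k<n - 1. 1 / real (k + 1)) = harm (n - 1)"
    by (simp add: harm_altdef inverse_eq_divide)
  ultimately have "((\<lambda>z::real. \<Sum>k<n - 1. z ^ k) has_integral harm (n - 1)) {0..1}" by simp
  then show ?thesis
  proof (rule has_integral_spike_finite[rotated 2])
    fix z :: real assume z: "z \<in> {0..1} - {1}"
    then have "1 - z > 0" by auto
    then show "(1 - z) powr (- 1) * (1 - z ^ (n - 1)) = (\<Sum>k<n - 1. z ^ k)"
      by (simp add: powr_minus sum_gp_strict field_simps)
  qed simp
qed

text \<open>Both Gamma estimates are log-convexity, applied to \<open>n < n + 1 - a < n + 1\<close> for \<open>a > 0\<close> and to
  \<open>n < n + 1 < n + 1 - a\<close> for \<open>a < 0\<close>.\<close>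

lemma Gamma_ratio_pos:
  assumes "0 < a" "a < 1" "n > 0"
  shows "real n powr (1 + a) \<le> (real n)\<^sup>2 * Gamma (real n) / Gamma (real n + 1 - a)"
proof -
  have n: "real n > 0" using assms by simp
  have G: "Gamma (real n) > 0" "Gamma (real n + 1) > 0" "Gamma (real n + 1 - a) > 0"
    using n assms by (auto intro: Gamma_real_pos)
  have "Gamma (real n + 1) = real n * Gamma (real n)"
    using n by (intro Gamma_plus1) auto
  then have Gn: "ln (Gamma (real n + 1)) = ln (real n) + ln (Gamma (real n))"
    using ln_mult_pos[OF n G(1)] by (simp only:)
  have pos: "real n powr (1 - a) * Gamma (real n) > 0"
    using n by (intro mult_pos_pos G) simp
  have L: "ln (real n powr (1 - a) * Gamma (real n)) = (1 - a) * ln (real n) + ln (Gamma (real n))"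
    using ln_mult_pos[OF _ G(1), of "real n powr (1 - a)"] n by (simp add: ln_powr)
  have sq: "real n powr (1 + a) * (real n powr (1 - a) * Gamma (real n)) = (real n)\<^sup>2 * Gamma (real n)"
    using n by (simp add: powr_add[symmetric] mult.assoc[symmetric])
  have "(ln \<circ> Gamma) ((1 - a) *\<^sub>R (real n + 1) + a *\<^sub>R real n) \<le>
      (1 - a) * (ln \<circ> Gamma) (real n + 1) + a * (ln \<circ> Gamma) (real n)"
    using assms by (intro convex_onD[OF log_convex_Gamma_real]) auto
  moreover have "(1 - a) *\<^sub>R (real n + 1) + a *\<^sub>R real n = real n + 1 - a"
    by (simp add: algebra_simps)
  ultimately have "ln (Gamma (real n + 1 - a)) \<le> (1 - a) * ln (Gamma (real n + 1)) + a * ln (Gamma (real n))"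
    by (simp only: o_def)
  also have "\<dots> = (1 - a) * ln (real n) + ln (Gamma (real n))"
    unfolding Gn by (simp add: algebra_simps)
  also have "\<dots> = ln (real n powr (1 - a) * Gamma (real n))"
    by (rule L[symmetric])
  finally have "Gamma (real n + 1 - a) \<le> real n powr (1 - a) * Gamma (real n)"
    by (rule ln_le_cancel_iff[OF G(3) pos, THEN iffD1])
  then have "real n powr (1 + a) * Gamma (real n + 1 - a) \<le> real n powr (1 + a) * (real n powr (1 - a) * Gamma (real n))"
    by (intro mult_left_mono) auto
  also have "\<dots> = (real n)\<^sup>2 * Gamma (real n)"
    by (rule sq)
  finally show ?thesis using G by (simp add: field_simps)
qed

lemma Gamma_ratio_neg:
  assumes "-1 < a" "a < 0" "n > 0"
  shows "(real n)\<^sup>2 * Gamma (real n) / Gamma (real n + 1 - a) \<le> real n powr (1 + a)"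
proof -
  have n: "real n > 0" using assms by simp
  have G: "Gamma (real n) > 0" "Gamma (real n + 1) > 0" "Gamma (real n + 1 - a) > 0"
    using n assms by (auto intro: Gamma_real_pos)
  have "Gamma (real n + 1) = real n * Gamma (real n)"
    using n by (intro Gamma_plus1) auto
  then have Gn: "ln (Gamma (real n + 1)) = ln (real n) + ln (Gamma (real n))"
    using ln_mult_pos[OF n G(1)] by (simp only:)
  have pos: "real n powr (1 - a) * Gamma (real n) > 0"
    using n by (intro mult_pos_pos G) simp
  have L: "ln (real n powr (1 - a) * Gamma (real n)) = (1 - a) * ln (real n) + ln (Gamma (real n))"
    using ln_mult_pos[OF _ G(1), of "real n powr (1 - a)"] n by (simp add: ln_powr)
  have sq: "real n powr (1 + a) * (real n powr (1 - a) * Gamma (real n)) = (real n)\<^sup>2 * Gamma (real n)"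
    using n by (simp add: powr_add[symmetric] mult.assoc[symmetric])
  \<comment> \<open>The weight that places n + 1 between n and n + 1 - a.\<close>
  define t where "t = 1 / (1 - a)"
  have t: "0 < t" "t < 1" "t * (1 - a) = 1" using assms by (auto simp: t_def)
  have "(ln \<circ> Gamma) ((1 - t) *\<^sub>R real n + t *\<^sub>R (real n + 1 - a)) \<le>
      (1 - t) * (ln \<circ> Gamma) (real n) + t * (ln \<circ> Gamma) (real n + 1 - a)"
    using assms t by (intro convex_onD[OF log_convex_Gamma_real]) auto
  moreover have "(1 - t) *\<^sub>R real n + t *\<^sub>R (real n + 1 - a) = real n + t * (1 - a)"
    by (simp add: algebra_simps)
  ultimately have "ln (Gamma (real n + 1)) \<le> (1 - t) * ln (Gamma (real n)) + t * ln (Gamma (real n + 1 - a))"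
    using t(3) by (simp only: o_def)
  then have "ln (real n) \<le> t * (ln (Gamma (real n + 1 - a)) - ln (Gamma (real n)))"
    unfolding Gn by (simp add: algebra_simps)
  then have "(1 - a) * ln (real n) \<le> (1 - a) * (t * (ln (Gamma (real n + 1 - a)) - ln (Gamma (real n))))"
    using assms by (intro mult_left_mono) auto
  also have "\<dots> = ln (Gamma (real n + 1 - a)) - ln (Gamma (real n))"
    using t(3) by (simp add: mult.assoc[symmetric] mult.commute)
  finally have "ln (real n powr (1 - a) * Gamma (real n)) \<le> ln (Gamma (real n + 1 - a))"
    unfolding L by simp
  then have "real n powr (1 - a) * Gamma (real n) \<le> Gamma (real n + 1 - a)"
    by (rule ln_le_cancel_iff[OF pos G(3), THEN iffD1])
  then have "real n powr (1 + a) * (real n powr (1 - a) * Gamma (real n)) \<le> real n powr (1 + a) * Gamma (real n + 1 - a)"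
    by (intro mult_left_mono) auto
  also have "real n powr (1 + a) * (real n powr (1 - a) * Gamma (real n)) = (real n)\<^sup>2 * Gamma (real n)"
    by (rule sq)
  finally show ?thesis using G by (simp add: field_simps)
qed

theorem corollary1p4:
  fixes n :: nat
  assumes "n \<ge> 2"
  shows "(\<forall>s::real. 0 < s \<and> s < 2 \<longrightarrow>
            optimal_riesz_energy s n - ereal (2 powr (1 - s) / (2 - s) * (real n)\<^sup>2)
              \<le> ereal (- (Gamma (1 - s / 2) / 2 powr s * real n powr (1 + s / 2))))
       \<and> (\<forall>s::real. -2 < s \<and> s < 0 \<longrightarrow>
            optimal_riesz_energy s n - ereal (2 powr (1 - s) / (2 - s) * (real n)\<^sup>2)
              \<ge> ereal (- (Gamma (1 - s / 2) / 2 powr s * real n powr (1 + s / 2))))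
       \<and> optimal_riesz_energy 2 n - ereal (1 / 4 * (real n)\<^sup>2 * ln (real n))
              \<le> ereal (euler_mascheroni / 4 * (real n)\<^sup>2)"
proof (intro conjI allI impI)
  have n: "n > 0" using assms by simp
  define I where "I s = 1 / (1 - s / 2) - Gamma (real n) * Gamma (1 - s / 2) / Gamma (real n + 1 - s / 2)" for s
  \<comment> \<open>The first part of \<open>I s\<close> cancels the n^2 term exactly, leaving a
    Gamma ratio to be compared with a power of n.\<close>
  have energy: "2 powr (- s) * (real n ^ 2 * I s) - 2 powr (1 - s) / (2 - s) * (real n)\<^sup>2 =
      - (Gamma (1 - s / 2) / 2 powr s * ((real n)\<^sup>2 * Gamma (real n) / Gamma (real n + 1 - s / 2)))"
    if "s < 2" for s
  proof -
    have "1 / (1 - s / 2) = 2 / (2 - s)" using that by (simp add: field_simps)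
    moreover have "2 powr (1 - s) = 2 * 2 powr (- s)" by (simp add: powr_diff powr_minus_divide)
    moreover have "P * (N * (2 / d - g * h / k)) - 2 * P / d * N = - (h * P * (N * g / k))"
      for P N d g h k :: real by (simp add: algebra_simps)
    moreover have "x / 2 powr s = x * 2 powr (- s)" for x by (simp add: powr_minus_divide)
    ultimately show ?thesis
      unfolding I_def by (simp only:)
  qed
  have nonneg: "Gamma (1 - s / 2) / 2 powr s \<ge> 0" if "s < 2" for s :: real
    using that by (intro divide_nonneg_nonneg Gamma_real_pos[THEN less_imp_le]) auto
  {
    fix s :: real assume s: "0 < s \<and> s < 2"
    then have "optimal_riesz_energy s n \<le> ereal (2 powr (- s) * (real n ^ 2 * I s))"
      unfolding I_def using n by (intro optimal_riesz_energy_le_integral has_integral_two_point_density) auto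
    then have "optimal_riesz_energy s n - ereal (2 powr (1 - s) / (2 - s) * (real n)\<^sup>2) \<le>
        ereal (2 powr (- s) * (real n ^ 2 * I s)) - ereal (2 powr (1 - s) / (2 - s) * (real n)\<^sup>2)"
      by (intro ereal_minus_mono) auto
    also have "\<dots> = ereal (- (Gamma (1 - s / 2) / 2 powr s *
        ((real n)\<^sup>2 * Gamma (real n) / Gamma (real n + 1 - s / 2))))"
      using s by (subst ereal_minus, subst energy) simp_all
    also have "\<dots> \<le> ereal (- (Gamma (1 - s / 2) / 2 powr s * real n powr (1 + s / 2)))"
      unfolding ereal_less_eq neg_le_iff_le
      using s n by (intro mult_left_mono Gamma_ratio_pos nonneg) auto
    finally show "optimal_riesz_energy s n - ereal (2 powr (1 - s) / (2 - s) * (real n)\<^sup>2)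
              \<le> ereal (- (Gamma (1 - s / 2) / 2 powr s * real n powr (1 + s / 2)))" .
  next
    fix s :: real assume s: "-2 < s \<and> s < 0"
    have "ereal (- (Gamma (1 - s / 2) / 2 powr s * real n powr (1 + s / 2))) \<le>
      ereal (- (Gamma (1 - s / 2) / 2 powr s *
        ((real n)\<^sup>2 * Gamma (real n) / Gamma (real n + 1 - s / 2))))"
      unfolding ereal_less_eq neg_le_iff_le
      using s n by (intro mult_left_mono Gamma_ratio_neg nonneg) auto
    also have "\<dots> = ereal (2 powr (- s) * (real n ^ 2 * I s)) - ereal (2 powr (1 - s) / (2 - s) * (real n)\<^sup>2)"
      using s by (subst ereal_minus, subst energy) simp_all
    also have "\<dots> \<le> optimal_riesz_energy s n - ereal (2 powr (1 - s) / (2 - s) * (real n)\<^sup>2)"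
      unfolding I_def using n s
      by (intro ereal_minus_mono optimal_riesz_energy_ge_integral has_integral_two_point_density) auto
    finally show "optimal_riesz_energy s n - ereal (2 powr (1 - s) / (2 - s) * (real n)\<^sup>2)
              \<ge> ereal (- (Gamma (1 - s / 2) / 2 powr s * real n powr (1 + s / 2)))" .
  }
  have "optimal_riesz_energy 2 n \<le> ereal (2 powr (- 2) * (real n ^ 2 * harm (n - 1)))"
    using has_integral_two_point_density_harm[OF n] n
    by (intro optimal_riesz_energy_le_integral) auto
  then have "optimal_riesz_energy 2 n - ereal (1 / 4 * (real n)\<^sup>2 * ln (real n)) \<le>
      ereal (2 powr (- 2) * (real n ^ 2 * harm (n - 1))) - ereal (1 / 4 * (real n)\<^sup>2 * ln (real n))"
    by (intro ereal_minus_mono) auto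
  also have "\<dots> = ereal ((harm (n - 1) - ln (real n)) / 4 * (real n)\<^sup>2)"
    by (simp add: powr_minus field_simps)
  also have "\<dots> \<le> ereal (euler_mascheroni / 4 * (real n)\<^sup>2)"
  proof -
    \<comment> \<open>The bound for the Euler constant is stated at a shifted index: its instance at
      n - 2 involves \<open>harm (n - 1)\<close> and \<open>ln n\<close>, which uses n \<ge>
      2.\<close>
    have "Suc (n - 2) = n - 1" "n - 2 + 2 = n" using assms by auto
    then have "harm (n - 1) - ln (real n) + 1 / real (2 * n) \<le> euler_mascheroni"
      using euler_mascheroni_lower[of "n - 2"] by simp
    moreover have "1 / real (2 * n) \<ge> 0" by simp
    ultimately have "harm (n - 1) - ln (real n) \<le> euler_mascheroni" by linarith
    then show ?thesis unfolding ereal_less_eq by (intro mult_right_mono divide_right_mono) auto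
  qed
  finally show "optimal_riesz_energy 2 n - ereal (1 / 4 * (real n)\<^sup>2 * ln (real n))
      \<le> ereal (euler_mascheroni / 4 * (real n)\<^sup>2)" .
qed

end
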